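(* If $n\geq 9$, then $R(S_n(4,1),W_8)=2n-1$.
   Context: All graphs are finite and simple. For graphs $G,H$, $R(G,H)$ is the smallest $N$ such that every graph $F$ of order $N$ either contains $G$ as a subgraph or has complement $\overline{F}$ containing $H$. $W_8$ is the wheel of order 9 (a hub joined to every vertex of a cycle $C_8$). $S_k$ is the star of order $k$. $S_n(4,1)$ is the tree of order $n$ obtained from $S_{n-4}$ by subdividing each of four chosen edges once, i.e. a center adjacent to $n-9$ leaves together with four pendant paths of 2 edges each starting at the center. *)

theory Defs
  imports Main
begin

type_synonym 'a graph = "'a set \<times> 'a set set"

abbreviation verts :: "'a graph \<Rightarrow> 'a set" where "verts \<equiv> fst"
abbreviation edges :: "'a graph \<Rightarrow> 'a set set" where "edges \<equiv> snd"

definition simple_graph :: "'a graph \<Rightarrow> bool" where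
  "simple_graph G \<longleftrightarrow> finite (verts G) \<and> (\<forall>e \<in> edges G. e \<subseteq> verts G \<and> card e = 2)"

definition graph_compl :: "'a graph \<Rightarrow> 'a graph" where
  "graph_compl G = (verts G, {e. e \<subseteq> verts G \<and> card e = 2 \<and> e \<notin> edges G})"

text \<open>\<open>F\<close> contains \<open>G\<close> if some, not necessarily induced, subgraph of \<open>F\<close> is isomorphic to \<open>G\<close>.\<close>

definition contains_graph :: "'a graph \<Rightarrow> 'b graph \<Rightarrow> bool" where
  "contains_graph F G \<longleftrightarrow>
    (\<exists>f. inj_on f (verts G) \<and> f ` verts G \<subseteq> verts F \<and> (\<forall>e \<in> edges G. f ` e \<in> edges F))"

text \<open>Every finite graph is isomorphic to one with vertices in \<open>nat\<close>, so it suffices to let \<open>F\<close>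
  range over these. A number \<open>N\<close> as required exists by Ramsey's theorem.\<close>

definition ramsey_number :: "'a graph \<Rightarrow> 'b graph \<Rightarrow> nat" where
  "ramsey_number G H =
    (LEAST N. \<forall>F :: nat graph. simple_graph F \<and> card (verts F) = N \<longrightarrow>
       contains_graph F G \<or> contains_graph (graph_compl F) H)"

definition cycle_graph :: "nat \<Rightarrow> nat graph" where
  "cycle_graph m = ({0..<m}, {{i, (i + 1) mod m} | i. i < m})"

text \<open>The index of a wheel is the length of its rim; the hub is the vertex \<open>m\<close>.\<close>

definition wheel :: "nat \<Rightarrow> nat graph" where
  "wheel m = (insert m (verts (cycle_graph m)),
     edges (cycle_graph m) \<union> {{m, i} | i. i \<in> verts (cycle_graph m)})"

text \<open>The index of a star is its order; the center is the vertex \<open>0\<close>.\<close>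

definition star :: "nat \<Rightarrow> nat graph" where
  "star k = ({0..<k}, {{0, i} | i. 0 < i \<and> i < k})"

text \<open>Subdivision of the edge \<open>{u, v}\<close> by the new vertex \<open>w\<close>.\<close>

definition subdivide :: "'a \<Rightarrow> 'a \<Rightarrow> 'a \<Rightarrow> 'a graph \<Rightarrow> 'a graph" where
  "subdivide u v w G = (insert w (verts G), edges G - {{u, v}} \<union> {{u, w}, {w, v}})"

text \<open>\<open>S_n(4,1)\<close>, for \<open>n \<ge> 9\<close>. By symmetry of the star it does not matter which four edges are
  subdivided.\<close>

definition S41 :: "nat \<Rightarrow> nat graph" where
  "S41 n =
    subdivide 0 4 (n - 1) (subdivide 0 3 (n - 2) (subdivide 0 2 (n - 3) (subdivide 0 1 (n - 4)
      (star (n - 4)))))"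

lemma verts_S41: "n \<ge> 9 \<Longrightarrow> verts (S41 n) = {0..<n}"
  by (auto simp: S41_def subdivide_def star_def)

lemma edges_S41:
  assumes "n \<ge> 9"
  shows "edges (S41 n) =
    {{0, i} | i. 5 \<le> i \<and> i < n} \<union> {{n - 4, 1}, {n - 3, 2}, {n - 2, 3}, {n - 1, 4}}"
proof -
  have "(\<lambda>i. {0, i}) ` ({1..<n - 4} - {1, 2, 3, 4}) =
      (\<lambda>i. {0, i}) ` {1..<n - 4} - (\<lambda>i. {0, i}) ` {1, 2, 3, 4 :: nat}"
    by (intro inj_on_image_set_diff[where C = UNIV]) (auto simp: inj_on_def doubleton_eq_iff)
  moreover have "{1..<n - 4} - {1, 2, 3, 4} = {i. 5 \<le> i \<and> i < n - 4}"
    by auto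
  moreover have "edges (star (n - 4)) = (\<lambda>i. {0, i}) ` {1..<n - 4}"
    by (auto simp: star_def)
  ultimately have star: "edges (star (n - 4)) - {{0, 1}} - {{0, 2}} - {{0, 3}} - {{0, 4}} =
      {{0, i} | i. 5 \<le> i \<and> i < n - 4}"
    by (simp add: setcompr_eq_image Diff_insert[symmetric] insert_commute)
  have new: "{{0, i} | i. 5 \<le> i \<and> i < n} = {{0, i} | i. 5 \<le> i \<and> i < n - 4} \<union>
      {{0, n - 4}, {0, n - 3}, {0, n - 2}, {0, n - 1}}"
  proof -
    have "{i. 5 \<le> i \<and> i < n} = {i. 5 \<le> i \<and> i < n - 4} \<union> {n - 4, n - 3, n - 2, n - 1}"
      using assms by auto
    then have "(\<lambda>i. {0, i}) ` {i. 5 \<le> i \<and> i < n} =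
      (\<lambda>i. {0, i}) ` ({i. 5 \<le> i \<and> i < n - 4} \<union> {n - 4, n - 3, n - 2, n - 1})"
      by simp
    then show ?thesis by (simp add: image_Un setcompr_eq_image)
  qed
  have swap: "(A \<union> {{0, a}, {a, b}}) - {{0, j}} = (A - {{0, j}}) \<union> {{0, a}, {a, b}}"
    if "0 < b" "j < a" for A and a b j :: nat
  proof -
    have "{0, j} \<noteq> {0, a}" "{0, j} \<noteq> {a, b}"
      using that by (auto simp: doubleton_eq_iff)
    then show ?thesis by blast
  qed
  have "n - 4 > 4" "n - 3 > 4" "n - 2 > 4" using assms by auto
  then have "edges (S41 n) =
      (edges (star (n - 4)) - {{0, 1}} - {{0, 2}} - {{0, 3}} - {{0, 4}}) \<union>
      {{0, n - 4}, {n - 4, 1}} \<union> {{0, n - 3}, {n - 3, 2}} \<union>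
      {{0, n - 2}, {n - 2, 3}} \<union> {{0, n - 1}, {n - 1, 4}}"
    unfolding S41_def subdivide_def snd_conv by (simp add: swap del: Un_insert_right Un_insert_left)
  moreover have "A \<union> {a, b} \<union> {c, d} \<union> {e, f} \<union> {g, h} = A \<union> {a, c, e, g} \<union> {b, d, f, h}"
    for A and a b c d e f g h :: "nat set"
    by auto
  ultimately show ?thesis
    unfolding star new by (rule trans)
qed

lemma simple_graph_S41:
  assumes "n \<ge> 9"
  shows "simple_graph (S41 n)"
proof -
  have "e \<subseteq> {0..<n} \<and> card e = 2" if e: "e \<in> edges (S41 n)" for e
  proof -
    obtain u v where "e = {u, v}" "u < n" "v < n" "u \<noteq> v"
    proof -
      consider i where "e = {0, i}" "5 \<le> i" "i < n"
        | "e = {n - 4, 1}" | "e = {n - 3, 2}" | "e = {n - 2, 3}" | "e = {n - 1, 4}"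
        using e unfolding edges_S41[OF assms] by blast
      then show thesis
        by cases (rule that, assumption, use assms in simp_all)+
    qed
    then show ?thesis by simp
  qed
  then show ?thesis
    unfolding simple_graph_def verts_S41[OF assms] by blast
qed

lemma simple_graph_wheel:
  assumes "m \<ge> 3"
  shows "simple_graph (wheel m)"
proof -
  have "e \<subseteq> {0..m} \<and> card e = 2" if e: "e \<in> edges (wheel m)" for e
  proof -
    consider i where "e = {i, (i + 1) mod m}" "i < m" | i where "e = {m, i}" "i < m"
      using e by (auto simp: wheel_def cycle_graph_def)
    then show ?thesis
    proof cases
      case (1 i)
      then have "(i + 1) mod m \<noteq> i" "(i + 1) mod m < m"
        using assms by (auto simp: mod_Suc)
      then show ?thesis using 1 by auto
    qed auto
  qed
  moreover have "verts (wheel m) = {0..m}"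
    by (auto simp: wheel_def cycle_graph_def)
  ultimately show ?thesis
    by (simp add: simple_graph_def)
qed

end

theory Submission
  imports Defs
begin

text \<open>
  Two disjoint complete graphs of order at most \<open>n - 1\<close> give the lower bound. For the upper bound, let a
  graph \<open>G\<close> of order \<open>2 n - 1\<close> contain no \<open>S\<^sub>n(4,1)\<close> and let its complement \<open>H\<close> contain no \<open>W\<^sub>8\<close>.
  Counting common \<open>H\<close>-neighbours shows that some vertex has \<open>G\<close>-degree at least \<open>n - 5\<close>. For a
  vertex \<open>v\<close> of maximum \<open>G\<close>-degree, four disjoint \<open>G\<close>-edges between the neighbours and the
  non-neighbours of \<open>v\<close> would yield \<open>S\<^sub>n(4,1)\<close>. So by Koenig's theorem at most three vertices cover
  all these edges, and deleting them leaves two sets \<open>P\<close>, \<open>Q\<close> that are completely joined in \<open>H\<close>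
  and contain all but three vertices. If both have at least four vertices, then \<open>G\<close> is almost
  complete on each of them, as an \<open>H\<close>-neighbourhood containing \<open>K\<^sub>4\<^sub>,\<^sub>4\<close> contains \<open>C\<^sub>8\<close>. An almost
  complete set of \<open>n\<close> vertices contains \<open>S\<^sub>n(4,1)\<close>. If \<open>P\<close> has only \<open>n - k\<close> vertices, then either
  \<open>k\<close> disjoint \<open>G\<close>-edges leave \<open>P\<close> and provide the ends of \<open>k\<close> legs of the spider, or, again by
  Koenig's theorem, \<open>Q\<close> can be enlarged to \<open>n\<close> vertices at the expense of few vertices of \<open>P\<close>.
\<close>

section \<open>Matchings\<close>

text \<open>Induction on \<open>card I\<close>. If every nonempty proper subset has a surplus
  neighbour, fixing one partner keeps Hall's condition. Otherwise a tight subset \<open>J\<close>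
  splits the problem into \<open>J\<close> and the rest.\<close>

lemma hall:
  assumes "finite I" "\<And>i. i \<in> I \<Longrightarrow> finite (N i)"
    and "\<And>J. J \<subseteq> I \<Longrightarrow> card J \<le> card (\<Union>j\<in>J. N j)"
  shows "\<exists>f. inj_on f I \<and> (\<forall>i\<in>I. f i \<in> N i)"
  using assms
proof (induction "card I" arbitrary: I N rule: less_induct)
  case less
  note fin = less.prems(1) and finN = less.prems(2) and hall = less.prems(3)
  show ?case
  proof (cases "I = {}")
    case False
    then obtain i where i: "i \<in> I" by blast
    show ?thesis
    proof (cases "\<exists>J. J \<noteq> {} \<and> J \<subset> I \<and> card (\<Union>j\<in>J. N j) = card J")
      case False
      have "card {i} \<le> card (\<Union>j\<in>{i}. N j)" using hall[of "{i}"] i by blast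
      then obtain b where b: "b \<in> N i" by fastforce
      have "\<exists>f. inj_on f (I - {i}) \<and> (\<forall>j\<in>I - {i}. f j \<in> N j - {b})"
      proof (rule less.hyps)
        show "card (I - {i}) < card I" using fin i by (intro psubset_card_mono) auto
        show "card J \<le> card (\<Union>j\<in>J. N j - {b})" if "J \<subseteq> I - {i}" for J
        proof (cases "J = {}")
          case nonempty: False
          have "J \<subset> I" using that i by blast
          then have "card J < card (\<Union>j\<in>J. N j)"
            using False nonempty hall[of J] by (metis le_neq_implies_less psubset_imp_subset)
          moreover have "(\<Union>j\<in>J. N j - {b}) = (\<Union>j\<in>J. N j) - {b}" by blast
          ultimately show ?thesis by (auto simp: card_Diff_singleton_if)
        qed simp
      qed (use fin finN in auto)
      then obtain f where f: "inj_on f (I - {i})" "\<And>j. j \<in> I - {i} \<Longrightarrow> f j \<in> N j - {b}" by blast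
      have "inj_on (f(i := b)) I"
        using f unfolding inj_on_def by (metis DiffI Diff_iff fun_upd_apply singletonD singletonI)
      moreover have "\<forall>j\<in>I. (f(i := b)) j \<in> N j" using f b by auto
      ultimately show ?thesis by blast
    next
      case True
      then obtain J where J: "J \<noteq> {}" "J \<subset> I" and tight: "card (\<Union>j\<in>J. N j) = card J" by blast
      define M where "M = (\<Union>j\<in>J. N j)"
      have finJ: "finite J" using J fin finite_subset by blast
      have finM: "finite M" using J finJ finN unfolding M_def by blast
      have "\<exists>f. inj_on f J \<and> (\<forall>j\<in>J. f j \<in> N j)"
        using J fin finN hall by (intro less.hyps psubset_card_mono finJ) auto
      then obtain f where f: "inj_on f J" "\<And>j. j \<in> J \<Longrightarrow> f j \<in> N j" by blast
      have "\<exists>g. inj_on g (I - J) \<and> (\<forall>j\<in>I - J. g j \<in> N j - M)"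
      proof (rule less.hyps)
        show "card (I - J) < card I" using fin J by (intro psubset_card_mono) auto
        show "card L \<le> card (\<Union>j\<in>L. N j - M)" if L: "L \<subseteq> I - J" for L
        proof -
          have finL: "finite L" using L fin finite_subset by blast
          have "card L + card J = card (L \<union> J)"
            using L finL finJ by (intro card_Un_disjoint[symmetric]) auto
          also have "\<dots> \<le> card (\<Union>j\<in>L \<union> J. N j)" using L J by (intro hall) auto
          also have "(\<Union>j\<in>L \<union> J. N j) = (\<Union>j\<in>L. N j - M) \<union> M" unfolding M_def by blast
          also have "card \<dots> \<le> card (\<Union>j\<in>L. N j - M) + card M" by (rule card_Un_le)
          finally show ?thesis using tight unfolding M_def by simp
        qed
      qed (use fin finN in auto)
      then obtain g where g: "inj_on g (I - J)" "\<And>j. j \<in> I - J \<Longrightarrow> g j \<in> N j - M" by blast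
      define h where "h = (\<lambda>j. if j \<in> J then f j else g j)"
      have "inj_on h I"
      proof (rule inj_onI)
        fix x y assume xy: "x \<in> I" "y \<in> I" "h x = h y"
        have "f j \<in> M" if "j \<in> J" for j using f that unfolding M_def by blast
        then have "x \<in> J \<longleftrightarrow> y \<in> J" using xy g unfolding h_def by (metis DiffD2 DiffI)
        then show "x = y"
          using xy f(1) g(1) unfolding h_def inj_on_def by (cases "x \<in> J") auto
      qed
      moreover have "\<forall>i\<in>I. h i \<in> N i" using f g unfolding h_def by auto
      ultimately show ?thesis by blast
    qed
  qed simp
qed

text \<open>The pairs are ordered because the first component later becomes the vertex of a leg next
  to the center, or the end of an edge on a prescribed side.\<close>

definition matching :: "('a \<Rightarrow> 'a \<Rightarrow> bool) \<Rightarrow> ('a \<times> 'a) list \<Rightarrow> bool" where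
  "matching K ms \<longleftrightarrow> distinct (map fst ms @ map snd ms) \<and> (\<forall>(a, b)\<in>set ms. K a b)"

definition cover :: "('a \<times> 'a) list \<Rightarrow> 'a set" where
  "cover ms = fst ` set ms \<union> snd ` set ms"

lemma finite_cover [simp]: "finite (cover ms)"
  by (simp add: cover_def)

lemma cover_simps [simp]:
  "cover [] = {}"
  "cover ((a, b) # ms) = insert a (insert b (cover ms))"
  "cover (ms @ ms') = cover ms \<union> cover ms'"
  by (auto simp: cover_def)

lemma matching_Nil [simp]: "matching K []"
  by (simp add: matching_def)

lemma matching_Cons [simp]:
  "matching K ((a, b) # ms) \<longleftrightarrow>
    K a b \<and> a \<noteq> b \<and> a \<notin> cover ms \<and> b \<notin> cover ms \<and> matching K ms"
  unfolding matching_def cover_def by auto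

lemma matching_append [simp]:
  "matching K (ms @ ms') \<longleftrightarrow> matching K ms \<and> matching K ms' \<and> cover ms \<inter> cover ms' = {}"
  by (induction ms) (auto simp: case_prod_beta)

lemma card_cover: "matching K ms \<Longrightarrow> card (cover ms) = 2 * length ms"
  by (induction ms) auto

lemma matching_mono: "matching K ms \<Longrightarrow> (\<And>a b. (a, b) \<in> set ms \<Longrightarrow> K a b \<Longrightarrow> L a b) \<Longrightarrow> matching L ms"
  unfolding matching_def by blast

text \<open>Koenig's theorem in its deficiency form: \<open>(A - S) \<union> N(S)\<close> is a small vertex cover.\<close>

lemma bipartite_matching_or_cover:
  assumes fin: "finite A" "finite B" and disj: "A \<inter> B = {}"
  obtains (matching) ms where "matching K ms" "length ms = k" "fst ` set ms \<subseteq> A" "snd ` set ms \<subseteq> B"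
  | (cover) S where "S \<subseteq> A" "card {b \<in> B. \<exists>a\<in>S. K a b} + card (A - S) < k"
proof (cases "\<exists>S\<subseteq>A. card {b \<in> B. \<exists>a\<in>S. K a b} + card (A - S) < k")
  case False
  \<comment> \<open>Every vertex of \<open>A\<close> gets the same \<open>card A - k\<close> dummy
    partners \<open>Inr i\<close>. Hall's condition then follows from the failure of the cover
    alternative, and at least \<open>k\<close> vertices receive a genuine partner.\<close>
  define N where "N = (\<lambda>a. Inl ` {b \<in> B. K a b} \<union> Inr ` {..<card A - k})"
  have kA: "k \<le> card A" using False[simplified, rule_format, of "{}"] by simp
  have "\<exists>f. inj_on f A \<and> (\<forall>a\<in>A. f a \<in> N a)"
  proof (rule hall[OF fin(1)])
    show "finite (N a)" for a unfolding N_def using fin by simp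
    show "card J \<le> card (\<Union>a\<in>J. N a)" if J: "J \<subseteq> A" for J
    proof (cases "J = {}")
      case nonempty: False
      have eq: "(\<Union>a\<in>J. N a) = Inl ` {b \<in> B. \<exists>a\<in>J. K a b} \<union> Inr ` {..<card A - k}"
        unfolding N_def using nonempty by auto
      have "card (\<Union>a\<in>J. N a) = card {b \<in> B. \<exists>a\<in>J. K a b} + (card A - k)"
        unfolding eq using fin by (subst card_Un_disjoint) (auto simp: card_image)
      moreover have "card {b \<in> B. \<exists>a\<in>J. K a b} + card (A - J) \<ge> k"
        using False J by (meson not_le)
      moreover have "card A = card J + card (A - J)"
        using J fin by (simp add: card_Diff_subset card_mono finite_subset)
      ultimately show ?thesis using kA by linarith
    qed simp
  qed
  then obtain f where f: "inj_on f A" "\<And>a. a \<in> A \<Longrightarrow> f a \<in> N a" by blast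
  define A' where "A' = {a \<in> A. f a \<in> range Inl}"
  have "f ` (A - A') \<subseteq> Inr ` {..<card A - k}"
    using f(2) unfolding A'_def N_def by blast
  then have "card (f ` (A - A')) \<le> card (Inr ` {..<card A - k} :: ('a + nat) set)"
    by (intro card_mono) auto
  then have "card (A - A') \<le> card A - k"
    using card_image[OF inj_on_subset[OF f(1)], of "A - A'"] by (simp add: card_image)
  moreover have "card A = card A' + card (A - A')"
    using fin unfolding A'_def by (subst card_Un_disjoint[symmetric]) (auto intro: arg_cong[where f = card])
  ultimately have "k \<le> card A'" using kA by linarith
  then obtain A'' where A'': "A'' \<subseteq> A'" "card A'' = k"
    by (meson obtain_subset_with_card_n)
  have finA'': "finite A''" using A'' fin unfolding A'_def by (auto intro: finite_subset)
  define g where "g = (\<lambda>a. projl (f a))"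
  have g: "g a \<in> B \<and> K a (g a)" if "a \<in> A''" for a
    using f(2)[of a] that A'' unfolding A'_def g_def N_def by auto
  have inj: "inj_on g A''"
  proof (rule inj_onI)
    fix x y assume "x \<in> A''" "y \<in> A''" "g x = g y"
    moreover from this have "f x \<in> range Inl" "f y \<in> range Inl"
      using A'' unfolding A'_def by auto
    ultimately have "f x = f y" "x \<in> A" "y \<in> A"
      using A'' unfolding A'_def g_def by auto
    then show "x = y" using f(1) unfolding inj_on_def by blast
  qed
  obtain xs where xs: "set xs = A''" "distinct xs" using finA'' finite_distinct_list by blast
  define ms where "ms = map (\<lambda>a. (a, g a)) xs"
  have maps: "map fst ms = xs" "map snd ms = map g xs" unfolding ms_def by (simp_all add: comp_def)
  show thesis
  proof (rule matching)
    have "A'' \<inter> g ` A'' = {}" using g disj A'' unfolding A'_def by blast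
    then show "matching K ms"
      unfolding matching_def maps using xs inj g by (auto simp: distinct_map ms_def)
    show "length ms = k" using xs A'' distinct_card[of xs] by (simp add: ms_def)
    show "fst ` set ms \<subseteq> A" "snd ` set ms \<subseteq> B" using g xs A'' unfolding ms_def A'_def by auto
  qed
qed (use cover in blast)

section \<open>Perfect matchings in sets with few non-neighbours\<close>

text \<open>Each edge contributes at least two missing adjacencies, one for each of the two ways to
  join its ends to \<open>y\<close> and \<open>z\<close>.\<close>

lemma card_nonadjacent_cover:
  assumes "matching K ms" "\<And>a b. (a, b) \<in> set ms \<Longrightarrow> (\<not> K y a \<or> \<not> K z b) \<and> (\<not> K z a \<or> \<not> K y b)"
  shows "2 * length ms \<le> card {x \<in> cover ms. \<not> K y x} + card {x \<in> cover ms. \<not> K z x}"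
  using assms
proof (induction ms)
  case (Cons p ms)
  obtain a b where p: "p = (a, b)" by (cases p)
  have *: "card {x \<in> cover (p # ms). \<not> K w x} =
    (if K w a then 0 else 1) + (if K w b then 0 else 1) + card {x \<in> cover ms. \<not> K w x}" for w
  proof -
    have "{x \<in> cover (p # ms). \<not> K w x} =
      (if K w a then {} else {a}) \<union> ((if K w b then {} else {b}) \<union> {x \<in> cover ms. \<not> K w x})"
      unfolding p by auto
    then show ?thesis using Cons.prems(1) unfolding p by auto
  qed
  have "(\<not> K y a \<or> \<not> K z b) \<and> (\<not> K z a \<or> \<not> K y b)" using Cons.prems(2)[of a b] p by simp
  moreover have "2 * length ms \<le> card {x \<in> cover ms. \<not> K y x} + card {x \<in> cover ms. \<not> K z x}"
    using Cons.prems p by (intro Cons.IH) auto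
  ultimately show ?case unfolding * by auto
qed simp

text \<open>A matching that is not perfect is enlarged by an edge between two uncovered vertices \<open>y\<close>,
  \<open>z\<close> or by replacing one of its edges \<open>{a, b}\<close> by \<open>{y, a}\<close> and \<open>{z, b}\<close>. If neither is possible,
  then \<open>y\<close> and \<open>z\<close> have too many non-neighbours.\<close>

lemma extend_matching:
  assumes fin: "finite X" and card: "card X = 2 * q" and sym: "\<And>x y. K x y \<Longrightarrow> K y x"
    and deg: "\<And>y. y \<in> X - F \<Longrightarrow> card {x \<in> X - {y}. \<not> K y x} < q"
    and ms: "matching K ms" "cover ms \<subseteq> X" "F \<subseteq> cover ms"
  shows "\<exists>ms'. matching K ms' \<and> cover ms' = X"
  using ms
proof (induction "q - length ms" arbitrary: ms rule: less_induct)
  case less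
  show ?case
  proof (cases "cover ms = X")
    case False
    have cc: "card (cover ms) = 2 * length ms" using less.prems card_cover by blast
    then have lt: "length ms < q"
      using psubset_card_mono[OF fin, of "cover ms"] less.prems False card by auto
    define L where "L = X - cover ms"
    have cL: "card L = 2 * q - 2 * length ms"
      using less.prems cc card unfolding L_def by (simp add: card_Diff_subset)
    have "2 \<le> card L" using cL lt by linarith
    then obtain y z where yz: "y \<in> L" "z \<in> L" "y \<noteq> z"
      by (metis card_2_iff' obtain_subset_with_card_n subsetD)
    \<comment> \<open>Covered vertices stay covered, so \<open>F\<close> remains covered and
      \<open>deg\<close> applies to every uncovered vertex.\<close>
    have "\<exists>ms'. matching K ms' \<and> cover ms \<subseteq> cover ms' \<and> cover ms' \<subseteq> X \<and> length ms' = Suc (length ms)"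
    proof (cases "\<exists>y\<in>L. \<exists>z\<in>L. y \<noteq> z \<and> K y z")
      case True
      then obtain y z where "y \<in> L" "z \<in> L" "y \<noteq> z" "K y z" by blast
      then show ?thesis
        using less.prems unfolding L_def by (intro exI[of _ "(y, z) # ms"]) auto
    next
      case indep: False
      show ?thesis
      proof (cases "\<exists>y\<in>L. \<exists>z\<in>L. y \<noteq> z \<and> (\<exists>(a, b)\<in>set ms. K y a \<and> K z b)")
        case True
        then obtain y z a b where *: "y \<in> L" "z \<in> L" "y \<noteq> z" "(a, b) \<in> set ms" "K y a" "K z b"
          by blast
        then obtain ms1 ms2 where ms: "ms = ms1 @ (a, b) # ms2" by (meson split_list)
        show ?thesis
          using less.prems * unfolding L_def ms
          by (intro exI[of _ "(y, a) # (z, b) # ms1 @ ms2"]) auto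
      next
        case False
        have sum: "2 * length ms \<le> card {x \<in> cover ms. \<not> K y x} + card {x \<in> cover ms. \<not> K z x}"
        proof (rule card_nonadjacent_cover[OF less.prems(1)])
          show "(\<not> K y a \<or> \<not> K z b) \<and> (\<not> K z a \<or> \<not> K y b)" if "(a, b) \<in> set ms" for a b
            using False yz that by (metis (mono_tags, lifting) case_prodI)
        qed
        \<comment> \<open>The other uncovered vertices are also non-neighbours of \<open>w\<close>.
          Adding the bounds for \<open>y\<close> and \<open>z\<close> to \<open>sum\<close> gives
          \<open>card L + length ms \<le> q\<close>, which is false for
          \<open>length ms < q\<close>.\<close>
        have "card L - 1 + card {x \<in> cover ms. \<not> K w x} < q" if w: "w \<in> L" for w
        proof -
          have nonadj: "\<not> K w x" if "x \<in> L - {w}" for x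
            using w indep that by (metis Diff_iff singleton_iff)
          have "(L - {w}) \<union> {x \<in> cover ms. \<not> K w x} \<subseteq> {x \<in> X - {w}. \<not> K w x}"
            using w less.prems(2) nonadj unfolding L_def by auto
          then have "card ((L - {w}) \<union> {x \<in> cover ms. \<not> K w x}) \<le> card {x \<in> X - {w}. \<not> K w x}"
            using fin by (intro card_mono) auto
          also have "\<dots> < q" using w less.prems(3) unfolding L_def by (intro deg) auto
          also have "card ((L - {w}) \<union> {x \<in> cover ms. \<not> K w x}) =
              card (L - {w}) + card {x \<in> cover ms. \<not> K w x}"
            using fin unfolding L_def by (intro card_Un_disjoint) auto
          finally show ?thesis using w by simp
        qed
        from sum this[OF yz(1)] this[OF yz(2)]
        have False using cL lt by linarith
        then show ?thesis ..
      qed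
    qed
    then obtain ms' where "matching K ms'" "cover ms \<subseteq> cover ms'" "cover ms' \<subseteq> X"
      "length ms' = Suc (length ms)" by blast
    then show ?thesis
      using less.hyps[of ms'] less.prems lt by auto
  qed (use less.prems in blast)
qed

text \<open>Serves to turn each edge of a matching so that its first end is adjacent to the center
  of a spider.\<close>

lemma orient_matching:
  assumes "matching K ms" "\<And>a b. K a b \<Longrightarrow> K b a" "\<And>a b. (a, b) \<in> set ms \<Longrightarrow> P a \<or> P b"
  shows "\<exists>ms'. matching K ms' \<and> cover ms' = cover ms \<and> (\<forall>(a, b)\<in>set ms'. P a)"
  using assms(1,3)
proof (induction ms)
  case (Cons p ms)
  obtain a b where p: "p = (a, b)" by (cases p)
  obtain ms' where ms': "matching K ms'" "cover ms' = cover ms" "\<forall>(a, b)\<in>set ms'. P a"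
    using Cons p by auto
  show ?case
  proof (cases "P a")
    case True
    then show ?thesis using ms' Cons.prems p by (intro exI[of _ "(a, b) # ms'"]) auto
  next
    case False
    then have "P b" using Cons.prems(2)[of a b] p by simp
    then show ?thesis using ms' Cons.prems(1) assms(2) p
      by (intro exI[of _ "(b, a) # ms'"]) auto
  qed
qed (auto intro: exI[of _ "[]"])

section \<open>Wheels in the complement\<close>

lemma ex_notin:
  assumes "card T < card C" "finite T"
  shows "\<exists>c\<in>C. c \<notin> T"
  using assms card_mono by (metis linorder_not_le subsetI)

lemma obtain_four:
  assumes "card S \<ge> 4"
  obtains a b c d where "distinct [a, b, c, d]" "{a, b, c, d} \<subseteq> S"
proof -
  obtain a where a: "a \<in> S" using ex_notin[of "{}" S] assms by auto
  obtain b where b: "b \<in> S" "b \<noteq> a" using ex_notin[of "{a}" S] assms by auto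
  obtain c where c: "c \<in> S" "c \<noteq> a" "c \<noteq> b" using ex_notin[of "{a, b}" S] assms b by auto
  obtain d where d: "d \<in> S" "d \<noteq> a" "d \<noteq> b" "d \<noteq> c"
    using ex_notin[of "{a, b, c}" S] assms b c by auto
  show thesis using that[of a b c d] a b c d by auto
qed

lemma card_le_Un: "finite X \<Longrightarrow> A \<subseteq> X \<Longrightarrow> B \<subseteq> X \<Longrightarrow> card A + card B \<le> card X + card (A \<inter> B)"
  by (metis card_Un_Int card_mono finite_subset le_sup_iff add_le_cancel_right)

definition nonadj :: "'a set \<Rightarrow> ('a \<Rightarrow> 'a \<Rightarrow> bool) \<Rightarrow> 'a \<Rightarrow> 'a \<Rightarrow> bool" where
  "nonadj V E x y \<longleftrightarrow> x \<in> V \<and> y \<in> V \<and> x \<noteq> y \<and> \<not> E x y"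

text \<open>A spider is \<open>S\<^sub>n(4,1)\<close>: with center \<open>c\<close>, the pairs in \<open>ms\<close> are the four legs of length two, the
  vertex nearer to \<open>c\<close> first, and \<open>L\<close> provides the remaining leaves.\<close>

locale counterexample =
  fixes V :: "'a set" and E :: "'a \<Rightarrow> 'a \<Rightarrow> bool" and n :: nat
  assumes finite_V: "finite V" and card_V: "card V = 2 * n - 1" and n: "n \<ge> 9"
    and sym: "E x y \<Longrightarrow> E y x" and irrefl: "\<not> E x x"
    and no_spider: "length ms = 4 \<Longrightarrow> matching E ms \<Longrightarrow> cover ms \<subseteq> V - {c} \<Longrightarrow> c \<in> V \<Longrightarrow>
      (\<forall>(a, b)\<in>set ms. E c a) \<Longrightarrow> L \<subseteq> V - cover ms \<Longrightarrow> (\<forall>l\<in>L. E c l) \<Longrightarrow> n - 9 \<le> card L \<Longrightarrow> False"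
    and no_wheel: "length xs = 8 \<Longrightarrow> distinct (h # xs) \<Longrightarrow> \<forall>x\<in>set xs. nonadj V E h x \<Longrightarrow>
      \<forall>i<8. nonadj V E (xs ! i) (xs ! ((i + 1) mod 8)) \<Longrightarrow> False"
begin

abbreviation H :: "'a \<Rightarrow> 'a \<Rightarrow> bool" where "H \<equiv> nonadj V E"

abbreviation joined :: "'a set \<Rightarrow> 'a set \<Rightarrow> bool" where
  "joined A B \<equiv> \<forall>a\<in>A. \<forall>b\<in>B. H a b"

lemma H_sym: "H x y \<Longrightarrow> H y x"
  unfolding nonadj_def using sym by blast

lemma H_irrefl [simp]: "\<not> H x x"
  unfolding nonadj_def by blast

lemma E_iff: "x \<in> V \<Longrightarrow> y \<in> V \<Longrightarrow> x \<noteq> y \<Longrightarrow> E x y \<longleftrightarrow> \<not> H x y"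
  unfolding nonadj_def by blast

lemma joined_sym: "joined A B \<Longrightarrow> joined B A"
  using H_sym by blast

lemma fin: "A \<subseteq> V \<Longrightarrow> finite A"
  using finite_V finite_subset by blast

lemma finite_E [simp]: "finite {y \<in> V. P y}"
  using finite_V by simp

section \<open>Explicit 8-cycles inside an \<open>H\<close>-neighbourhood\<close>

lemma wheel8:
  assumes "distinct [x1, x2, x3, x4, x5, x6, x7, x8]"
    and "H h x1" "H h x2" "H h x3" "H h x4" "H h x5" "H h x6" "H h x7" "H h x8"
    and "H x1 x2" "H x2 x3" "H x3 x4" "H x4 x5" "H x5 x6" "H x6 x7" "H x7 x8" "H x8 x1"
  shows False
proof (rule no_wheel[of "[x1, x2, x3, x4, x5, x6, x7, x8]" h])
  show hub: "\<forall>x\<in>set [x1, x2, x3, x4, x5, x6, x7, x8]. H h x"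
    by (simp add: assms)
  then have "h \<notin> set [x1, x2, x3, x4, x5, x6, x7, x8]" using H_irrefl by blast
  then show "distinct (h # [x1, x2, x3, x4, x5, x6, x7, x8])" using assms(1) by simp
  show "\<forall>i<8. H ([x1, x2, x3, x4, x5, x6, x7, x8] ! i)
      ([x1, x2, x3, x4, x5, x6, x7, x8] ! ((i + 1) mod 8))"
  proof (intro allI impI)
    fix i :: nat
    assume "i < 8"
    then consider "i = 0" | "i = 1" | "i = 2" | "i = 3" | "i = 4" | "i = 5" | "i = 6" | "i = 7"
      by linarith
    then show "H ([x1, x2, x3, x4, x5, x6, x7, x8] ! i)
        ([x1, x2, x3, x4, x5, x6, x7, x8] ! ((i + 1) mod 8))"
      by cases (simp_all add: assms)
  qed
qed simp

text \<open>The rim is \<open>x1, c1, x2, c2, x3, c3, x4, c4\<close>. The connecting vertices are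
  picked from \<open>c4\<close> down to \<open>c1\<close>, each avoiding the at most three picked
  before.\<close>

lemma wheel_from_common:
  assumes x: "distinct [x1, x2, x3, x4]" "H h x1" "H h x2" "H h x3" "H h x4"
    and C: "\<And>c. c \<in> C1 \<Longrightarrow> H h c \<and> H x1 c \<and> H x2 c" "\<And>c. c \<in> C2 \<Longrightarrow> H h c \<and> H x2 c \<and> H x3 c"
      "\<And>c. c \<in> C3 \<Longrightarrow> H h c \<and> H x3 c \<and> H x4 c" "\<And>c. c \<in> C4 \<Longrightarrow> H h c \<and> H x4 c \<and> H x1 c"
    and disj: "{x1, x2, x3, x4} \<inter> (C1 \<union> C2 \<union> C3 \<union> C4) = {}"
    and card: "card C1 \<ge> 4" "card C2 \<ge> 4" "card C3 \<ge> 3" "card C4 \<ge> 3"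
  shows False
proof -
  obtain c4 where c4: "c4 \<in> C4" using card(4) by fastforce
  obtain c3 where c3: "c3 \<in> C3" "c3 \<noteq> c4"
    using ex_notin[of "{c4}" C3] card by auto
  obtain c2 where c2: "c2 \<in> C2" "c2 \<noteq> c4" "c2 \<noteq> c3"
    using ex_notin[of "{c4, c3}" C2] card c3 by auto
  obtain c1 where c1: "c1 \<in> C1" "c1 \<noteq> c4" "c1 \<noteq> c3" "c1 \<noteq> c2"
    using ex_notin[of "{c4, c3, c2}" C1] card c3 c2 by auto
  have dist: "distinct [x1, c1, x2, c2, x3, c3, x4, c4]"
  proof -
    have "{c1, c2, c3, c4} \<subseteq> C1 \<union> C2 \<union> C3 \<union> C4" using c1 c2 c3 c4 by blast
    then have "{x1, x2, x3, x4} \<inter> {c1, c2, c3, c4} = {}" using disj by blast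
    then show ?thesis using x c1 c2 c3 c4 by auto
  qed
  show False
    by (rule wheel8[OF dist, of h])
      (simp_all add: x C(1)[OF c1(1)] C(2)[OF c2(1)] C(3)[OF c3(1)] C(4)[OF c4]
        H_sym[of x2 c1] H_sym[of x3 c2] H_sym[of x4 c3] H_sym[of x1 c4])
qed

text \<open>Four vertices of \<open>A\<close> alternate on the rim with four vertices of
  \<open>B\<close>.\<close>

lemma wheel_from_bipartite:
  assumes "A \<inter> B = {}" "joined A B" "\<And>x. x \<in> A \<union> B \<Longrightarrow> H h x" "card A \<ge> 4" "card B \<ge> 4"
  shows False
proof -
  obtain x1 x2 x3 x4 where x: "distinct [x1, x2, x3, x4]" "{x1, x2, x3, x4} \<subseteq> A"
    using obtain_four[OF assms(4)] .
  show False
    by (rule wheel_from_common[OF x(1), of h B B B B]) (use x assms in auto)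
qed

text \<open>The vertices \<open>x1\<close>, \<open>x2\<close>, \<open>x3\<close> cut the rim into
  three segments inside \<open>P\<close> with five vertices in total: of sizes 2, 2, 1 if the two
  edges are disjoint, and 3, 1, 1 if they share a vertex.\<close>

lemma wheel_from_three:
  assumes x: "distinct [x1, x2, x3]" "H h x1" "H h x2" "H h x3"
    and P: "card P \<ge> 5" "joined {x1, x2, x3} P" "\<And>p. p \<in> P \<Longrightarrow> H h p"
    and edges: "a \<in> P" "b \<in> P" "c \<in> P" "d \<in> P" "H a b" "H c d" "{a, b} \<noteq> {c, d}"
  shows False
proof -
  have PX: "x1 \<notin> P" "x2 \<notin> P" "x3 \<notin> P" using P(2) H_irrefl by blast+
  have J: "H x p \<and> H p x" if "p \<in> P" "x \<in> {x1, x2, x3}" for p x using P that H_sym by metis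
  have path: False if pq: "p \<in> P" "q \<in> P" "r \<in> P" "H p q" "H q r" "p \<noteq> r" for p q r
  proof -
    have pqr: "p \<noteq> q" "q \<noteq> r" using pq by auto
    obtain s where s: "s \<in> P" "s \<notin> {p, q, r}"
      using ex_notin[of "{p, q, r}" P] P pq pqr by auto
    obtain t where t: "t \<in> P" "t \<notin> {p, q, r, s}"
      using ex_notin[of "{p, q, r, s}" P] P pq pqr s by auto
    have "distinct [x1, p, q, r, x2, s, x3, t]" using x(1) PX pq(1-3,6) pqr s t by auto
    then show False
      by (rule wheel8[of x1 p q r x2 s x3 t h]) (simp_all add: x P(3) J pq s t)
  qed
  show False
  proof (cases "{a, b} \<inter> {c, d} = {}")
    case True
    then have dist: "distinct [a, b, c, d]" using edges by auto
    obtain e where e: "e \<in> P" "e \<notin> {a, b, c, d}"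
      using ex_notin[of "{a, b, c, d}" P] P dist by auto
    have "distinct [x1, a, b, x2, c, d, x3, e]" using x(1) PX dist e edges(1-4) by auto
    then show False
      by (rule wheel8[of x1 a b x2 c d x3 e h]) (simp_all add: x P(3) J e edges)
  next
    case False
    then consider "a = c" | "a = d" | "b = c" | "b = d" by blast
    then show False
    proof cases
      case 1
      then show False using path[of b a d] edges H_sym[OF edges(5)] by auto
    next
      case 2
      then show False using path[of b a c] edges H_sym[OF edges(5)] H_sym[OF edges(6)] by auto
    next
      case 3
      then show False using path[of a b d] edges by auto
    next
      case 4
      then show False using path[of a b c] edges H_sym[OF edges(6)] by auto
    qed
  qed
qed

text \<open>The vertices \<open>q1\<close> and \<open>q2\<close> close the path
  \<open>c, f, a, g\<close> and the edge \<open>b, d\<close> to an 8-cycle.\<close>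

lemma wheel_from_path_and_edge:
  assumes h: "H h q1" "H h q2" "q1 \<noteq> q2" and P: "joined {h, q1, q2} P"
    and path: "{c, f, a, g, b, d} \<subseteq> P" "distinct [c, f, a, g, b, d]" "H c f" "H f a" "H a g" "H b d"
  shows False
proof -
  have PX: "q1 \<notin> P" "q2 \<notin> P" using P H_irrefl by blast+
  have J: "H x p \<and> H p x" if "p \<in> {c, f, a, g, b, d}" "x \<in> {h, q1, q2}" for p x
    using P path(1) that H_sym by (metis subsetD)
  have "distinct [q1, c, f, a, g, q2, b, d]" using h(3) PX path(1,2) by auto
  then show False
    by (rule wheel8[of q1 c f a g q2 b d h]) (simp_all add: h J path)
qed

end

section \<open>Spiders in dense sets\<close>

lemma at_most_one: "finite A \<Longrightarrow> (\<And>x y. x \<in> A \<Longrightarrow> y \<in> A \<Longrightarrow> x = y) \<Longrightarrow> card A \<le> 1"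
  by (metis One_nat_def card_le_Suc0_iff_eq)

lemma card_fst_matching: "matching K ms \<Longrightarrow> card (fst ` set ms) = length ms"
  unfolding matching_def by (metis distinct_append distinct_card length_map set_map)

lemma card_split: "finite A \<Longrightarrow> card A = card {a \<in> A. P a} + card {a \<in> A. \<not> P a}"
  by (subst card_Un_disjoint[symmetric]) (auto intro: arg_cong[where f = card])

context counterexample
begin

lemma H_neq: "H x y \<Longrightarrow> x \<noteq> y"
  unfolding nonadj_def by blast

lemma joined_disjoint: "joined P Q \<Longrightarrow> P \<inter> Q = {}"
  using H_neq by blast

section \<open>Spiders in a set \<open>P\<close> on which \<open>G\<close> is almost
  complete\<close>

text \<open>The pairs in \<open>ps\<close> are \<open>k\<close> legs whose far ends lie outside
  \<open>P\<close>; those in \<open>ms\<close> become the other \<open>4 - k\<close> legs. As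
  \<open>ms\<close> covers all \<open>H\<close>-neighbours of \<open>c\<close> in \<open>P\<close>,
  the remaining vertices of \<open>P\<close> can be leaves.\<close>

lemma spider_from_center:
  assumes P: "P \<subseteq> V" "card P + k \<ge> n" "c \<in> P"
    and ps: "matching E ps" "length ps = k" "fst ` set ps \<subseteq> P - {c}" "snd ` set ps \<subseteq> V - P"
      "\<And>p. p \<in> fst ` set ps \<Longrightarrow> \<not> H c p"
    and ms: "matching E ms" "length ms + k = 4" "cover ms \<subseteq> P - {c} - fst ` set ps"
      "{y \<in> P. H c y} \<subseteq> cover ms" "\<And>a b. (a, b) \<in> set ms \<Longrightarrow> \<not> H c a \<or> \<not> H c b"
  shows False
proof -
  obtain ms' where ms': "matching E ms'" "cover ms' = cover ms" "\<forall>(a, b)\<in>set ms'. \<not> H c a"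
    using orient_matching[of E ms "\<lambda>a. \<not> H c a"] ms(1,5) sym by blast
  have finP: "finite P" using P fin by blast
  have len: "length ms' = length ms" using card_cover[OF ms'(1)] card_cover[OF ms(1)] ms'(2) by simp
  have sub: "fst ` set ms' \<subseteq> cover ms" using ms'(2) unfolding cover_def by blast
  \<comment> \<open>The set \<open>P\<close> loses \<open>c\<close>, the \<open>k\<close> near ends
    in \<open>ps\<close> and twice \<open>4 - k\<close> vertices in \<open>ms\<close>, which leaves
    \<open>card P + k - 9\<close> leaves.\<close>
  define L where "L = P - {c} - fst ` set ps - cover ms"
  have "card L = card P - 1 - k - 2 * length ms"
  proof -
    have "card (P - {c} - fst ` set ps) = card (P - {c}) - k"
      using ps(3) card_fst_matching[OF ps(1)] ps(2) by (subst card_Diff_subset) auto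
    then show ?thesis
      using ms(3) card_cover[OF ms(1)] P(3) finP unfolding L_def by (subst card_Diff_subset) auto
  qed
  then have cL: "n - 9 \<le> card L" using ms(2) P(2) by linarith
  show False
  proof (rule no_spider[of "ps @ ms'" c L])
    have cps: "cover ps = fst ` set ps \<union> snd ` set ps" by (rule cover_def)
    then have disj: "cover ps \<inter> cover ms' = {}" using ps(4) ms(3) ms'(2) by auto
    show "length (ps @ ms') = 4" using len ms(2) ps(2) by simp
    show "matching E (ps @ ms')" using ps(1) ms'(1) disj by simp
    show "cover (ps @ ms') \<subseteq> V - {c}"
      using cps ps(3,4) ms(3) ms'(2) P(1,3) by auto
    show "c \<in> V" using P by blast
    have "E c a" if "(a, b) \<in> set ps" for a b
    proof -
      have "a \<in> fst ` set ps" using that by force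
      then have "a \<in> P" "a \<noteq> c" "\<not> H c a" using ps(3,5) by auto
      then show ?thesis using P(1,3) E_iff[of c a] by blast
    qed
    moreover have "E c a" if "(a, b) \<in> set ms'" for a b
    proof -
      have "a \<in> cover ms" using that sub by force
      moreover have "\<not> H c a" using that ms'(3) by blast
      ultimately show ?thesis using ms(3) P(1,3) E_iff[of c a] by blast
    qed
    ultimately show "\<forall>(a, b)\<in>set (ps @ ms'). E c a" by auto
    show "L \<subseteq> V - cover (ps @ ms')"
      using P(1) ps(4) ms'(2) cps unfolding L_def by auto
    show "\<forall>l\<in>L. E c l"
      using P(1,3) ms(4) E_iff[of c] unfolding L_def by blast
  qed (rule cL)
qed

text \<open>The near ends of \<open>ps\<close> have together at most \<open>k\<close> times
  \<open>r\<close> \<open>H\<close>-neighbours in \<open>P\<close>, fewer than there are candidates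
  for a center. The set \<open>X\<close> is to be split into the legs inside
  \<open>P\<close>.\<close>

lemma center_exists:
  assumes P: "P \<subseteq> V" "card P + k \<ge> n" and deg: "\<And>x. x \<in> P \<Longrightarrow> card {y \<in> P. H x y} \<le> r"
    and kr: "k * r + 2 * k < 9" "r + k \<le> 4"
    and ps: "matching E ps" "length ps = k" "fst ` set ps \<subseteq> P"
  obtains c X where "c \<in> P - fst ` set ps" "\<And>p. p \<in> fst ` set ps \<Longrightarrow> \<not> H c p"
    "{y \<in> P. H c y} \<subseteq> X" "X \<subseteq> P - {c} - fst ` set ps" "card X = 2 * (4 - k)"
proof -
  have finP: "finite P" using P fin by blast
  define T where "T = (\<Union>p\<in>fst ` set ps. {y \<in> P. H p y})"
  have "card T \<le> (\<Sum>p\<in>fst ` set ps. card {y \<in> P. H p y})"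
    unfolding T_def by (intro card_UN_le) simp
  also have "\<dots> \<le> card (fst ` set ps) * r"
    using deg ps(3) sum_bounded_above[of "fst ` set ps" "\<lambda>p. card {y \<in> P. H p y}" r] by auto
  also have "\<dots> = k * r" using card_fst_matching[OF ps(1)] ps(2) by simp
  finally have T: "card T \<le> k * r" .
  have cO: "card (P - fst ` set ps) = card P - k"
    using ps(3) card_fst_matching[OF ps(1)] ps(2) by (subst card_Diff_subset) auto
  have "card T < card (P - fst ` set ps)" using T cO kr P(2) n by linarith
  moreover have "finite T" using finP unfolding T_def by simp
  ultimately obtain c where c: "c \<in> P - fst ` set ps" "c \<notin> T" using ex_notin by blast
  have nH: "\<not> H c p" if "p \<in> fst ` set ps" for p
    using that c ps(3) H_sym unfolding T_def by blast
  have "card (P - {c} - fst ` set ps) = card P - k - 1"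
    using c cO by (metis Diff_insert Diff_insert2 card_Diff_singleton)
  then have "2 * (4 - k) \<le> card (P - {c} - fst ` set ps)" using n P(2) by linarith
  moreover have "card {y \<in> P. H c y} \<le> 2 * (4 - k)"
    using deg[of c] c kr by fastforce
  moreover have "{y \<in> P. H c y} \<subseteq> P - {c} - fst ` set ps" using nH by auto
  ultimately obtain X where "{y \<in> P. H c y} \<subseteq> X" "X \<subseteq> P - {c} - fst ` set ps" "card X = 2 * (4 - k)"
    using exists_subset_between[of "{y \<in> P. H c y}" "2 * (4 - k)" "P - {c} - fst ` set ps"] finP by auto
  then show thesis using that c nH by blast
qed

text \<open>For a suitable center, Koenig's theorem matches its \<open>H\<close>-neighbours into the
  rest of \<open>X\<close>; then \<open>extend_matching\<close> yields a perfect matching of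
  \<open>X\<close>, which provides the missing legs.\<close>

lemma no_dense_set_with_pendants:
  assumes P: "P \<subseteq> V" "card P + k \<ge> n" "k \<le> 3" and deg: "\<And>x. x \<in> P \<Longrightarrow> card {y \<in> P. H x y} \<le> 3 - k"
    and ps: "matching E ps" "length ps = k" "fst ` set ps \<subseteq> P" "snd ` set ps \<subseteq> V - P"
  shows False
proof -
  have finP: "finite P" using P fin by blast
  have "k = 0 \<or> k = 1 \<or> k = 2 \<or> k = 3" using P(3) by linarith
  then have kr: "k * (3 - k) + 2 * k < 9" by auto
  obtain c X where c: "c \<in> P - fst ` set ps" "\<And>p. p \<in> fst ` set ps \<Longrightarrow> \<not> H c p"
    and X: "{y \<in> P. H c y} \<subseteq> X" "X \<subseteq> P - {c} - fst ` set ps" "card X = 2 * (4 - k)"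
    using center_exists[OF P(1,2) deg kr _ ps(1-3)] P(3) by auto
  define F where "F = {y \<in> P. H c y}"
  \<comment> \<open>Vertices of \<open>F\<close> cannot be next to the center. An edge of
    \<open>K\<close> has an end outside \<open>F\<close> and can therefore be a leg.\<close>
  define K where "K = (\<lambda>a b. E a b \<and> \<not> (a \<in> F \<and> b \<in> F))"
  have cF: "card F \<le> 3 - k" using deg c unfolding F_def by blast
  have finX: "finite X" using X(2) finP finite_subset by blast
  have FX: "F \<subseteq> X" "finite F" using X(1) finX finite_subset unfolding F_def by auto
  have nonK: "H x y" if "x \<in> X" "y \<in> X" "x \<noteq> y" "\<not> K x y" "x \<notin> F \<or> y \<notin> F" for x y
    using that X(2) P(1) E_iff[of x y] unfolding K_def by blast
  obtain ms0 where ms0: "matching K ms0" "cover ms0 \<subseteq> X" "F \<subseteq> cover ms0"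
  proof (rule bipartite_matching_or_cover[of F "X - F" K "card F"])
    fix ms assume ms: "matching K ms" "length ms = card F" "fst ` set ms \<subseteq> F" "snd ` set ms \<subseteq> X - F"
    have "fst ` set ms = F"
      using card_fst_matching[OF ms(1)] ms(2,3) FX(2) by (metis card_subset_eq)
    then show thesis using that[of ms] ms FX unfolding cover_def by blast
  next
    fix S assume S: "S \<subseteq> F" "card {b \<in> X - F. \<exists>a\<in>S. K a b} + card (F - S) < card F"
    \<comment> \<open>One of the at most \<open>3 - k\<close> \<open>H\<close>-neighbours of
      \<open>a\<close> is \<open>c\<close>, which is not in \<open>X\<close>. So \<open>a\<close>
      has too many \<open>K\<close>-neighbours in \<open>X - F\<close> for the cover
      alternative.\<close>
    then obtain a where a: "a \<in> S" by fastforce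
    have aP: "a \<in> P" "H a c" "a \<in> X" using a S(1) FX H_sym unfolding F_def by auto
    have "H a b" if "b \<in> X - F" "\<not> K a b" for b
      using nonK[of a b] that aP(3) a S(1) by blast
    then have "insert c {b \<in> X - F. \<not> K a b} \<subseteq> {y \<in> P. H a y}"
      using aP(2) c(1) X(2) by blast
    then have "card (insert c {b \<in> X - F. \<not> K a b}) \<le> 3 - k"
      using finP by (intro order.trans[OF card_mono[of "{y \<in> P. H a y}"] deg[OF aP(1)]]) auto
    moreover have "c \<notin> {b \<in> X - F. \<not> K a b}" using X(2) by blast
    ultimately have 1: "card {b \<in> X - F. \<not> K a b} + 1 \<le> 3 - k" using finX by simp
    have "card (X - F) = card {b \<in> X - F. K a b} + card {b \<in> X - F. \<not> K a b}"
      by (rule card_split) (use finX in simp)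
    moreover have "card (X - F) = card X - card F" using FX by (simp add: card_Diff_subset)
    moreover have "card {b \<in> X - F. K a b} \<le> card {b \<in> X - F. \<exists>a\<in>S. K a b}"
      using a finX by (intro card_mono) auto
    ultimately show thesis using 1 S(2) X(3) cF by linarith
  qed (use FX finX in auto)
  have "\<exists>ms. matching K ms \<and> cover ms = X"
  proof (rule extend_matching[OF finX X(3) _ _ ms0])
    show "K y x" if "K x y" for x y using that sym unfolding K_def by blast
    show "card {x \<in> X - {y}. \<not> K y x} < 4 - k" if y: "y \<in> X - F" for y
    proof -
      have "{x \<in> X - {y}. \<not> K y x} \<subseteq> {x \<in> P. H y x}" using nonK[of y] y X(2) by blast
      then have "card {x \<in> X - {y}. \<not> K y x} \<le> card {x \<in> P. H y x}"
        using finP by (intro card_mono) auto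
      also have "\<dots> \<le> 3 - k" using y X(2) by (intro deg) auto
      finally show ?thesis using P(3) by linarith
    qed
  qed
  then obtain ms where ms: "matching K ms" "cover ms = X" by blast
  show False
  proof (rule spider_from_center[OF P(1,2) _ ps(1,2) _ ps(4) c(2)])
    show "matching E ms" using ms(1) by (rule matching_mono) (simp add: K_def)
    show "length ms + k = 4" using card_cover[OF ms(1)] ms(2) X(3) P(3) by simp
    show "\<not> H c a \<or> \<not> H c b" if "(a, b) \<in> set ms" for a b
    proof -
      have "K a b" using ms(1) that unfolding matching_def by blast
      moreover have "a \<in> cover ms" "b \<in> cover ms" using that unfolding cover_def by force+
      ultimately show ?thesis using X(2) ms(2) unfolding K_def F_def by blast
    qed
  qed (use c ps X ms in auto)
qed

lemma no_dense_set:
  assumes "P \<subseteq> V" "card P \<ge> n" "\<And>x. x \<in> P \<Longrightarrow> card {y \<in> P. H x y} \<le> 3"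
  shows False
  using no_dense_set_with_pendants[of P 0 "[]"] assms by simp

section \<open>Two sets that are completely joined in \<open>H\<close>\<close>

text \<open>Four \<open>H\<close>-neighbours of \<open>x\<close> inside \<open>Q\<close> and four
  vertices of \<open>P\<close> would form a complete bipartite graph in the
  \<open>H\<close>-neighbourhood of \<open>x\<close>.\<close>

lemma inner_degree:
  assumes "joined P Q" "card P \<ge> 4" "x \<in> Q"
  shows "card {y \<in> Q. H x y} \<le> 3"
proof (rule ccontr)
  assume "\<not> ?thesis"
  then show False
    using assms joined_disjoint[OF assms(1)] joined_sym[OF assms(1)]
    by (intro wheel_from_bipartite[of "{y \<in> Q. H x y}" P x]) auto
qed

text \<open>Without \<open>k\<close> disjoint edges from \<open>P\<close> to the vertices outside
  \<open>P\<close> and \<open>Q\<close>, Koenig's theorem gives \<open>S\<close>. Adding to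
  \<open>Q\<close> all outside vertices with no \<open>G\<close>-neighbour in \<open>S\<close> makes
  a set of at least \<open>n\<close> vertices joined to \<open>S\<close>, which
  \<open>no_dense_set\<close> excludes.\<close>

lemma pendants_exist:
  assumes P: "P \<subseteq> V" "Q \<subseteq> V" "joined P Q" "card P + k = n" "k \<le> 3"
    and no_pendants: "\<And>ps. matching E ps \<Longrightarrow> length ps = k \<Longrightarrow> fst ` set ps \<subseteq> P \<Longrightarrow>
      snd ` set ps \<subseteq> V - P \<Longrightarrow> False"
  shows False
proof (rule bipartite_matching_or_cover[of P "V - P - Q" E k])
  fix ps assume "matching E ps" "length ps = k" "fst ` set ps \<subseteq> P" "snd ` set ps \<subseteq> V - P - Q"
  then show False using no_pendants[of ps] by blast
next
  define R where "R = V - P - Q"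
  fix S assume "S \<subseteq> P" "card {b \<in> V - P - Q. \<exists>a\<in>S. E a b} + card (P - S) < k"
  then have S: "S \<subseteq> P" "card {b \<in> R. \<exists>a\<in>S. E a b} + card (P - S) < k" unfolding R_def by auto
  have finite: "finite P" "finite Q" "finite R" using P(1,2) finite_V finite_subset unfolding R_def by auto
  \<comment> \<open>The sizes work out because at most \<open>k - 1\<close> vertices are lost:
    \<open>Q'\<close> keeps at least \<open>(2n - 1) - (n - k) - (k - 1) = n\<close> vertices and
    \<open>S\<close> at least \<open>n - 2k + 1\<close>, hence four.\<close>
  define Q' where "Q' = Q \<union> (R - {b \<in> R. \<exists>a\<in>S. E a b})"
  have Q'V: "Q' \<subseteq> V" using P(1,2) unfolding Q'_def R_def by blast
  have disj: "P \<inter> Q = {}" using P(3) by (rule joined_disjoint)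
  have "card V = card P + card Q + card R"
  proof -
    have "V = (P \<union> Q) \<union> R" using P(1,2) unfolding R_def by blast
    moreover have "(P \<union> Q) \<inter> R = {}" unfolding R_def by blast
    ultimately show ?thesis using finite disj by (simp add: card_Un_disjoint)
  qed
  moreover have "card Q' = card Q + (card R - card {b \<in> R. \<exists>a\<in>S. E a b})"
  proof -
    have "Q \<inter> (R - {b \<in> R. \<exists>a\<in>S. E a b}) = {}" unfolding R_def by blast
    then show ?thesis using finite unfolding Q'_def by (simp add: card_Un_disjoint card_Diff_subset)
  qed
  ultimately have cQ': "card Q' \<ge> n" using P(4) S(2) card_V n by linarith
  have cS: "card S \<ge> 4"
  proof -
    have "card P = card S + card (P - S)"
      using S(1) finite by (simp add: card_Diff_subset card_mono finite_subset)
    then show ?thesis using P(4,5) S(2) n by linarith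
  qed
  have "joined S Q'"
  proof (intro ballI)
    fix a b assume a: "a \<in> S" and b: "b \<in> Q'"
    show "H a b"
    proof (cases "b \<in> Q")
      case True
      then show ?thesis using P(3) S(1) a by blast
    next
      case False
      then have "b \<in> R" "\<not> E a b" using a b unfolding Q'_def by blast+
      moreover have "a \<in> P" using a S(1) by blast
      ultimately show ?thesis using P(1) unfolding R_def nonadj_def by blast
    qed
  qed
  then show False using no_dense_set[OF Q'V cQ'] inner_degree[OF _ cS] by blast
qed (use fin[OF P(1)] finite_V in auto)

text \<open>Used in contrapositive form, to find a vertex of \<open>P\<close> with at least
  \<open>4 - k\<close> \<open>H\<close>-neighbours in \<open>P\<close>.\<close>

lemma no_dense_side:
  assumes "P \<subseteq> V" "Q \<subseteq> V" "joined P Q" "card P + k = n" "k \<le> 3"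
    and "\<And>x. x \<in> P \<Longrightarrow> card {y \<in> P. H x y} \<le> 3 - k"
  shows False
proof (rule pendants_exist[OF assms(1-5)])
  fix ps assume ps: "matching E ps" "length ps = k" "fst ` set ps \<subseteq> P" "snd ` set ps \<subseteq> V - P"
  have "n \<le> card P + k" using assms(4) by simp
  then show False by (rule no_dense_set_with_pendants[OF assms(1) _ assms(5,6) ps])
qed

text \<open>One leg \<open>x, y\<close> is to be found inside \<open>P\<close>, but a single
  \<open>H\<close>-edge already exceeds the bound \<open>3 - k = 0\<close> of
  \<open>no_dense_set_with_pendants\<close>. If this edge lies in \<open>Q\<close>, its ends become
  the center and the far end \<open>y\<close>; otherwise \<open>Q\<close> has a center without
  \<open>H\<close>-neighbours in \<open>P\<close>.\<close>

lemma no_near_clique_with_three_pendants: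
  assumes P: "P \<subseteq> V" "card P + 3 = n"
    and one: "\<And>a b c d. a \<in> P \<Longrightarrow> b \<in> P \<Longrightarrow> c \<in> P \<Longrightarrow> d \<in> P \<Longrightarrow> H a b \<Longrightarrow> H c d \<Longrightarrow> {a, b} = {c, d}"
    and ps: "matching E ps" "length ps = 3" "fst ` set ps \<subseteq> P" "snd ` set ps \<subseteq> V - P"
  shows False
proof -
  define Q where "Q = P - fst ` set ps"
  have QP: "Q \<subseteq> P" and finP: "finite P" using P fin unfolding Q_def by auto
  have "card Q = card P - 3"
    using ps(3) card_fst_matching[OF ps(1)] ps(2) unfolding Q_def by (subst card_Diff_subset) auto
  then have cQ: "card Q \<ge> 3" using P n by linarith
  have spider: False if cxy: "c \<in> Q" "x \<in> Q" "y \<in> Q" "x \<noteq> y" "c \<noteq> x" "c \<noteq> y" "\<not> H x y" "\<not> H c x"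
    "{u \<in> P. H c u} \<subseteq> {y}" for c x y
  proof (rule spider_from_center[of P 3 c ps "[(x, y)]"])
    have "x \<in> V" "y \<in> V" using cxy(2,3) QP P(1) by blast+
    then show "matching E [(x, y)]" using cxy(4,7) E_iff[of x y] by simp
    show "\<not> H c p" if p: "p \<in> fst ` set ps" for p
    proof -
      have "p \<in> P" "p \<noteq> y" using p ps(3) cxy(3) unfolding Q_def by auto
      then show ?thesis using cxy(9) by blast
    qed
    show "cover [(x, y)] \<subseteq> P - {c} - fst ` set ps" using cxy(2,3,5,6) unfolding Q_def by auto
    show "\<not> H c a \<or> \<not> H c b" if "(a, b) \<in> set [(x, y)]" for a b using that \<open>\<not> H c x\<close> by simp
    show "fst ` set ps \<subseteq> P - {c}" using ps(3) cxy(1) unfolding Q_def by blast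
    show "{u \<in> P. H c u} \<subseteq> cover [(x, y)]" using cxy(9) by auto
    show "c \<in> P" "n \<le> card P + 3" using cxy(1) QP P(2) by auto
  qed (use P(1) ps in simp_all)
  show False
  proof (cases "\<exists>a\<in>Q. \<exists>b\<in>Q. H a b")
    case True
    then obtain a b where ab: "a \<in> Q" "b \<in> Q" "H a b" "a \<noteq> b" using H_neq by blast
    obtain x where x: "x \<in> Q" "x \<notin> {a, b}" using ex_notin[of "{a, b}" Q] cQ ab by auto
    have *: "{u, w} = {a, b}" if "u \<in> P" "w \<in> P" "H u w" for u w
      using one[OF that(1,2) _ _ that(3) ab(3)] ab(1,2) QP by blast
    show False
    proof (rule spider[of a x b])
      show "\<not> H x b" using *[of x b] x ab QP by (auto simp: doubleton_eq_iff)
      show "\<not> H a x" using *[of a x] x ab QP by (auto simp: doubleton_eq_iff)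
      show "{u \<in> P. H a u} \<subseteq> {b}"
      proof
        fix u assume "u \<in> {u \<in> P. H a u}"
        then have "{a, u} = {a, b}" using *[of a u] ab(1) QP by blast
        then show "u \<in> {b}" by (auto simp: doubleton_eq_iff)
      qed
    qed (use x ab in auto)
  next
    case noedge: False
    obtain c where c: "c \<in> Q" "\<And>u. u \<in> P \<Longrightarrow> \<not> H c u"
    proof (cases "\<exists>a\<in>P. \<exists>b\<in>P. H a b")
      case True
      then obtain a b where ab: "a \<in> P" "b \<in> P" "H a b" "a \<noteq> b" using H_neq by blast
      obtain c where c: "c \<in> Q" "c \<notin> {a, b}" using ex_notin[of "{a, b}" Q] cQ ab by auto
      have "\<not> H c u" if "u \<in> P" for u
      proof
        assume "H c u"
        then have "{c, u} = {a, b}" using one[OF _ that ab(1,2) _ ab(3)] c(1) QP by blast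
        then show False using c(2) by blast
      qed
      then show thesis using that c(1) by blast
    next
      case False
      obtain c where "c \<in> Q" using cQ by fastforce
      then show thesis using that False QP by blast
    qed
    obtain x where x: "x \<in> Q" "x \<notin> {c}" using ex_notin[of "{c}" Q] cQ by auto
    obtain y where y: "y \<in> Q" "y \<notin> {c, x}" using ex_notin[of "{c, x}" Q] cQ x by auto
    have "\<not> H x y" "\<not> H c x" "{u \<in> P. H c u} \<subseteq> {y}" using c x(1) y(1) noedge QP by blast+
    then show False using spider[of c x y] c(1) x y by fastforce
  qed
qed

text \<open>The bound 2 on the \<open>H\<close>-degrees exceeds the bound \<open>3 - k = 1\<close>
  that suffices for a spider with \<open>k = 2\<close> pendant edges. The failure to build one
  forces the configuration of \<open>wheel_from_path_and_edge\<close>.\<close>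

lemma spider_or_path_and_edge:
  assumes P: "P \<subseteq> V" "card P + 2 = n" and deg: "\<And>x. x \<in> P \<Longrightarrow> card {y \<in> P. H x y} \<le> 2"
    and ps: "matching E ps" "length ps = 2" "fst ` set ps \<subseteq> P" "snd ` set ps \<subseteq> V - P"
  obtains (path_and_edge) c f a g b d where "{c, f, a, g, b, d} \<subseteq> P" "distinct [c, f, a, g, b, d]"
    "H c f" "H f a" "H a g" "H b d"
proof -
  have finP: "finite P" using P(1) by (rule fin)
  have Pn: "n \<le> card P + 2" using P(2) by simp
  obtain c X where c: "c \<in> P - fst ` set ps" "\<And>p. p \<in> fst ` set ps \<Longrightarrow> \<not> H c p"
    and X: "{y \<in> P. H c y} \<subseteq> X" "X \<subseteq> P - {c} - fst ` set ps" "card X = 4"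
    using center_exists[OF P(1) Pn deg _ _ ps(1-3)] by auto
  define F where "F = {y \<in> P. H c y}"
  define K where "K = (\<lambda>a b. E a b \<and> \<not> (a \<in> F \<and> b \<in> F))"
  have Ksym: "K y x" if "K x y" for x y using that sym unfolding K_def by blast
  have XP: "X \<subseteq> P" "finite X" "c \<notin> X" using X(2) finP finite_subset by blast+
  have EH: "E x y" if "x \<in> P" "y \<in> P" "x \<noteq> y" "\<not> H x y" for x y
    using that P(1) E_iff[of x y] by blast
  have pairs: "z = u \<or> z = w" if "x \<in> P" "u \<in> P" "w \<in> P" "u \<noteq> w" "H x u" "H x w" "z \<in> P" "H x z" for x u w z
  proof (rule ccontr)
    assume "\<not> ?thesis"
    then have "card {u, w, z} = 3" using that(4) by auto
    moreover have "card {u, w, z} \<le> card {y \<in> P. H x y}" using that finP by (intro card_mono) auto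
    ultimately show False using deg[OF that(1)] by simp
  qed
  have spider: False if "e \<in> P - fst ` set ps" "distinct [e, x, y, z, w]"
    "{x, y, z, w} \<subseteq> P - fst ` set ps" "\<not> H x y" "\<not> H z w" "\<not> H e x \<or> \<not> H e y" "\<not> H e z \<or> \<not> H e w"
    "{u \<in> P. H e u} \<subseteq> {x, y, z, w}" for e x y z w
  proof (rule spider_from_center[OF P(1) Pn _ ps(1,2) _ ps(4), of e "[(x, y), (z, w)]"])
    show "\<not> H e p" if p: "p \<in> fst ` set ps" for p
    proof
      assume "H e p"
      then have "p \<in> {x, y, z, w}" using p ps(3) \<open>{u \<in> P. H e u} \<subseteq> {x, y, z, w}\<close> by blast
      then show False using p \<open>{x, y, z, w} \<subseteq> P - fst ` set ps\<close> by blast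
    qed
    have "E x y" "E z w" using that(2-5) by (auto intro!: EH)
    then show "matching E [(x, y), (z, w)]" using that(2) by auto
    show "\<not> H e a \<or> \<not> H e b" if "(a, b) \<in> set [(x, y), (z, w)]" for a b
      using that \<open>\<not> H e x \<or> \<not> H e y\<close> \<open>\<not> H e z \<or> \<not> H e w\<close> by auto
  qed (use that(1-3,8) ps(3) in auto)
  \<comment> \<open>For \<open>x\<close> in \<open>F\<close>, one of its at most two
    \<open>H\<close>-neighbours is \<open>c\<close>, which lies outside \<open>X\<close>. This makes
    up for the at most one other element of \<open>F\<close>.\<close>
  have nonK: "card {y \<in> X - {x}. \<not> K x y} \<le> 2" if x: "x \<in> X" for x
  proof (cases "x \<in> F")
    case False
    have "{y \<in> X - {x}. \<not> K x y} \<subseteq> {y \<in> P. H x y}"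
      using EH[of x] x XP(1) False unfolding K_def by blast
    then have "card {y \<in> X - {x}. \<not> K x y} \<le> card {y \<in> P. H x y}"
      using finP by (intro card_mono) simp_all
    also have "\<dots> \<le> 2" using x XP(1) by (intro deg) blast
    finally show ?thesis .
  next
    case True
    then have xc: "c \<in> {y \<in> P. H x y}" using c(1) H_sym unfolding F_def by blast
    have "{y \<in> X - {x}. \<not> K x y} \<subseteq> ({y \<in> P. H x y} - {c}) \<union> (F - {x})"
      using EH[of x] x XP unfolding K_def by blast
    then have "card {y \<in> X - {x}. \<not> K x y} \<le> card (({y \<in> P. H x y} - {c}) \<union> (F - {x}))"
      using finP unfolding F_def by (intro card_mono) auto
    also have "\<dots> \<le> card ({y \<in> P. H x y} - {c}) + card (F - {x})" by (rule card_Un_le)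
    also have "\<dots> = (card {y \<in> P. H x y} - 1) + (card F - 1)" using xc True by simp
    also have "\<dots> \<le> 2"
    proof -
      have "card {y \<in> P. H x y} \<le> 2" "card F \<le> 2"
        using x XP(1) c(1) unfolding F_def by (blast intro: deg)+
      then show ?thesis by linarith
    qed
    finally show ?thesis .
  qed
  have noK: "\<not> (K x y \<and> K z w)" if xyzw: "X = {x, y, z, w}" "distinct [x, y, z, w]" for x y z w
  proof
    assume K: "K x y \<and> K z w"
    show False
    proof (rule spider[of c x y z w])
      show "\<not> H x y" "\<not> H z w" using K unfolding K_def nonadj_def by blast+
      show "\<not> H c x \<or> \<not> H c y" "\<not> H c z \<or> \<not> H c w"
        using K xyzw(1) XP(1) unfolding K_def F_def by blast+
    qed (use xyzw X XP(3) c(1) in auto)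
  qed
  \<comment> \<open>On the four vertices of \<open>X\<close>, \<open>K\<close> has no isolated
    vertex and no perfect matching. So it is a star, with center \<open>b\<close>.\<close>
  have "\<exists>a b y z. X = {a, b, y, z} \<and> distinct [a, b, y, z] \<and>
    \<not> K y z \<and> \<not> K a y \<and> \<not> K a z \<and> K a b \<and> K y b \<and> K z b"
  proof -
    obtain a where a: "a \<in> X" using X(3) by fastforce
    have "card {y \<in> X - {a}. \<not> K a y} < card (X - {a})" using nonK[OF a] X(3) a by simp
    then obtain b where b: "b \<in> X" "b \<noteq> a" "K a b"
      using ex_notin[of "{y \<in> X - {a}. \<not> K a y}" "X - {a}"] XP(2) by auto
    obtain y where y: "y \<in> X" "y \<notin> {a, b}" using ex_notin[of "{a, b}" X] X(3) b by auto
    obtain z where z: "z \<in> X" "z \<notin> {a, b, y}" using ex_notin[of "{a, b, y}" X] X(3) b y by auto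
    have d: "distinct [a, b, y, z]" using b y z by auto
    then have "card {a, b, y, z} = card X" using X(3) by simp
    then have eq: "X = {a, b, y, z}" using a b y z XP(2) by (metis card_subset_eq empty_subsetI insert_subset)
    have three: "K u p \<or> K u q \<or> K u r" if "u \<in> X" "{p, q, r} \<subseteq> X - {u}" "distinct [p, q, r]" for u p q r
    proof (rule ccontr)
      assume "\<not> ?thesis"
      then have "card {p, q, r} \<le> card {y \<in> X - {u}. \<not> K u y}"
        using that XP(2) by (intro card_mono) auto
      then show False using nonK[OF that(1)] that(3) by simp
    qed
    have 1: "\<not> K y z" using noK[of a b y z] eq d b by blast
    have 2: "\<not> (K a y \<and> K b z)" using noK[of a y b z] eq d by auto
    have 3: "\<not> (K a z \<and> K b y)" using noK[of a z b y] eq d by auto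
    have 4: "K y a \<or> K y b" using three[of y a b z] 1 eq d by auto
    have 5: "K z a \<or> K z b" using three[of z a b y] 1 Ksym eq d by auto
    show ?thesis
    proof (cases "K a y")
      case True
      then have "\<not> K b z" "K a z" "\<not> K b y" using 2 3 5 Ksym by blast+
      then show ?thesis using True 1 b(3) eq d Ksym
        by (intro exI[of _ b] exI[of _ a] exI[of _ y] exI[of _ z]) auto
    next
      case False
      then have "K b y" "\<not> K a z" "K b z" using 3 4 5 Ksym by blast+
      then show ?thesis using False 1 b(3) eq d Ksym
        by (intro exI[of _ a] exI[of _ b] exI[of _ y] exI[of _ z]) auto
    qed
  qed
  then obtain a b y z where eq: "X = {a, b, y, z}" and d: "distinct [a, b, y, z]"
    and nK: "\<not> K y z" "\<not> K a y" "\<not> K a z" and Kb: "K a b" "K y b" "K z b" by blast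
  have inP: "a \<in> P" "b \<in> P" "y \<in> P" "z \<in> P" "c \<in> P" using eq XP c(1) by auto
  have ne: "c \<noteq> a" "c \<noteq> b" "c \<noteq> y" "c \<noteq> z" using XP(3) eq by auto
  have noH: "\<not> H a b" "\<not> H y b" "\<not> H z b" and notF: "a \<in> F \<or> y \<in> F \<or> z \<in> F \<Longrightarrow> b \<notin> F"
    using Kb unfolding K_def nonadj_def by auto
  have FX: "F \<subseteq> {a, b, y, z}" using X(1) eq unfolding F_def by simp
  have cF: "H c u \<longleftrightarrow> u \<in> F" if "u \<in> P" for u using that unfolding F_def by simp
  \<comment> \<open>If the leaves \<open>y\<close> and \<open>z\<close> of this star lie in
    \<open>F\<close>, then \<open>c, y, a, z\<close> is a 4-cycle of \<open>H\<close>. Either an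
    \<open>H\<close>-edge at \<open>b\<close> goes with the path \<open>c, y, a, z\<close>, or
    \<open>b\<close> is the center of a spider with legs \<open>c, a\<close> and
    \<open>y, z\<close>.\<close>
  have twoF: thesis if a: "a \<in> P" "a \<notin> F" "a \<in> X" and yz: "y \<in> F" "z \<in> F" "y \<in> X" "z \<in> X"
    and b: "b \<in> P" "b \<notin> F" "b \<in> X" and d: "distinct [a, b, y, z]"
    and H: "H y a" "H z a" "\<not> H a b" "\<not> H y b" "\<not> H z b" for a b y z
  proof -
    have yzP: "y \<in> P" "z \<in> P" "H c y" "H c z" using yz unfolding F_def by auto
    have ne: "c \<noteq> a" "c \<noteq> b" "c \<noteq> y" "c \<noteq> z" using XP(3) a b yz by auto
    show thesis
    proof (cases "\<exists>u\<in>P. H b u")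
      case True
      then obtain u where u: "u \<in> P" "H b u" by blast
      have "u \<notin> {a, y, z}" using u H H_sym by blast
      moreover have "u \<noteq> c" using u b H_sym cF by blast
      moreover have "u \<noteq> b" using H_neq[OF u(2)] by simp
      ultimately show thesis
        using d ne path_and_edge[of c y a z b u] yzP a(1) b(1) u H inP(5) H_sym[OF H(2)] by auto
    next
      case False
      have "False"
      proof (rule spider[of b c a y z])
        show "\<not> H c a" using a cF by blast
        show "\<not> H y z"
          using pairs[of y c a z] yzP a(1) inP(5) ne H(1) H_sym[OF yzP(3)] d by auto
      qed (use False a b yz X(2) d ne c(1) in auto)
      then show thesis ..
    qed
  qed
  have Hxy: "H u w" if "u \<in> {a, y, z}" "w \<in> {a, y, z}" "u \<noteq> w" "\<not> (u \<in> F \<and> w \<in> F)" for u w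
  proof -
    have "\<not> K u w" using that nK Ksym by auto
    then show ?thesis using EH[of u w] that inP unfolding K_def by auto
  qed
  consider "y \<in> F" "z \<in> F" | "y \<in> F" "a \<in> F" | "z \<in> F" "a \<in> F"
    | "\<not> (y \<in> F \<and> z \<in> F)" "\<not> (y \<in> F \<and> a \<in> F)" "\<not> (z \<in> F \<and> a \<in> F)" by blast
  then show thesis
  proof cases
    case 1
    have "b \<notin> F" using notF 1 by simp
    moreover have "a \<notin> F"
      using pairs[of c y z a] 1 inP cF d by auto
    ultimately show thesis
      using twoF[of a y z b] 1 inP d eq Hxy[of y a] Hxy[of z a] noH by auto
  next
    case 2
    have "b \<notin> F" using notF 2 by simp
    moreover have "z \<notin> F" using pairs[of c y a z] 2 inP cF d by auto
    ultimately show thesis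
      using twoF[of z y a b] 2 inP d eq Hxy[of y z] Hxy[of a z] noH by auto
  next
    case 3
    have "b \<notin> F" using notF 3 by simp
    moreover have "y \<notin> F" using pairs[of c z a y] 3 inP cF d by auto
    ultimately show thesis
      using twoF[of y z a b] 3 inP d eq Hxy[of z y] Hxy[of a y] noH by auto
  next
    case 4
    \<comment> \<open>Now \<open>a\<close>, \<open>y\<close>, \<open>z\<close> form a triangle in
      \<open>H\<close>. So \<open>y\<close> has no further \<open>H\<close>-neighbour in
      \<open>P\<close> and is the center of a spider with legs \<open>c, z\<close> and
      \<open>b, a\<close>.\<close>
    have T: "H y z" "H y a" "H z y" "H z a" using 4 Hxy d by auto
    have "False"
    proof (rule spider[of y c z b a])
      show "\<not> H c z"
        using pairs[of z y a c] T inP ne d H_sym[of c z] by auto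
      show "\<not> H b a" using noH(1) H_sym[of b a] by blast
      show "\<not> H y c \<or> \<not> H y z"
        using pairs[of y z a c] T inP ne d by auto
      show "{u \<in> P. H y u} \<subseteq> {c, z, b, a}"
        using pairs[of y z a] T inP d by auto
      show "\<not> H y b \<or> \<not> H y a" using noH(2) by simp
    qed (use eq d ne X(2) c(1) in auto)
    then show thesis ..
  qed
qed

text \<open>Two \<open>H\<close>-edges in \<open>P\<close> would give a wheel with hub
  \<open>x\<close> by \<open>wheel_from_three\<close>, applied to three \<open>H\<close>-neighbours
  of \<open>x\<close> in \<open>Q\<close>.\<close>

lemma few_edges:
  assumes J: "joined P Q" and P: "card P \<ge> 5" and x: "x \<in> Q" "card {y \<in> Q. H x y} \<ge> 3"
    and e: "a \<in> P" "b \<in> P" "c \<in> P" "d \<in> P" "H a b" "H c d"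
  shows "{a, b} = {c, d}"
proof (rule ccontr)
  assume ne: "{a, b} \<noteq> {c, d}"
  obtain x1 where x1: "x1 \<in> Q" "H x x1"
    using ex_notin[of "{}" "{y \<in> Q. H x y}"] x(2) by auto
  obtain x2 where x2: "x2 \<in> Q" "H x x2" "x2 \<noteq> x1"
    using ex_notin[of "{x1}" "{y \<in> Q. H x y}"] x(2) by auto
  obtain x3 where x3: "x3 \<in> Q" "H x x3" "x3 \<noteq> x1" "x3 \<noteq> x2"
    using ex_notin[of "{x1, x2}" "{y \<in> Q. H x y}"] x(2) x2(3) by auto
  have J': "joined Q P" using J by (rule joined_sym)
  have dist: "distinct [x1, x2, x3]" using x2(3) x3(3,4) by auto
  show False
    by (rule wheel_from_three[OF dist x1(2) x2(2) x3(2) P _ _ e ne])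
      (use J' x(1) x1(1) x2(1) x3(1) in blast)+
qed

text \<open>The sizes leave two cases: \<open>P\<close> has \<open>n - 1\<close> vertices, or both
  sides have \<open>n - 2\<close>. By \<open>no_dense_side\<close> a side of \<open>n - k\<close>
  vertices contains a vertex with \<open>4 - k\<close> \<open>H\<close>-neighbours in it, and a
  vertex with three on one side allows at most one \<open>H\<close>-edge on the other.\<close>

lemma no_joined_sides:
  assumes PQ: "P \<subseteq> V" "Q \<subseteq> V" "joined P Q" and sizes: "card P + card Q + 4 \<ge> 2 * n"
    and lt: "card Q \<le> card P" "card P < n"
    and deg: "\<And>x. x \<in> P \<Longrightarrow> card {y \<in> P. H x y} \<le> 3" "\<And>x. x \<in> Q \<Longrightarrow> card {y \<in> Q. H x y} \<le> 3"
  shows False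
proof -
  have QP: "joined Q P" using PQ(3) by (rule joined_sym)
  have fin: "finite P" "finite Q" using PQ(1,2) finite_V finite_subset by blast+
  have cards: "card Q \<ge> 5" "card P \<ge> 5" using sizes lt n by linarith+
  have near: "card {y \<in> B. H x y} \<le> 1" "a \<in> B \<Longrightarrow> b \<in> B \<Longrightarrow> c \<in> B \<Longrightarrow> d \<in> B \<Longrightarrow> H a b \<Longrightarrow> H c d \<Longrightarrow> {a, b} = {c, d}"
    if B: "joined B A" "card B \<ge> 5" "finite B" and z: "z \<in> A" "card {y \<in> A. H z y} \<ge> 3" "x \<in> B"
    for A B x z a b c d
  proof -
    show "card {y \<in> B. H x y} \<le> 1"
    proof (rule at_most_one)
      fix u v assume "u \<in> {y \<in> B. H x y}" "v \<in> {y \<in> B. H x y}"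
      then have "{x, u} = {x, v}" using few_edges[OF B(1,2) z(1,2) z(3) _ z(3)] by blast
      then show "u = v" by (auto simp: doubleton_eq_iff)
    qed (use B(3) in simp)
    show "{a, b} = {c, d}" if "a \<in> B" "b \<in> B" "c \<in> B" "d \<in> B" "H a b" "H c d"
      using few_edges[OF B(1,2) z(1,2)] that by blast
  qed
  obtain q where q: "q \<in> Q" using cards(1) by fastforce
  consider "card P + 1 = n" | "card P + 2 = n" "card Q + 2 = n" using sizes lt by linarith
  then show False
  proof cases
    case 1
    obtain x where x: "x \<in> P" "card {y \<in> P. H x y} \<ge> 3"
      using no_dense_side[OF PQ 1] by fastforce
    have Q1: "card {y \<in> Q. H u y} \<le> 1" if "u \<in> Q" for u
      using near(1)[OF QP cards(1) fin(2) x that] .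
    consider "card Q + 1 = n" | "card Q + 2 = n" | "card Q + 3 = n" using sizes lt 1 by linarith
    then show False
    proof cases
      case 1
      have "card {y \<in> Q. H u y} \<le> 3 - 1" if "u \<in> Q" for u using Q1[OF that] by simp
      then show False using no_dense_side[OF PQ(2,1) QP 1] by simp
    next
      case 2
      have "card {y \<in> Q. H u y} \<le> 3 - 2" if "u \<in> Q" for u using Q1[OF that] by simp
      then show False using no_dense_side[OF PQ(2,1) QP 2] by simp
    next
      case 3
      show False
      proof (rule pendants_exist[OF PQ(2,1) QP 3])
        fix ps assume ps: "matching E ps" "length ps = 3" "fst ` set ps \<subseteq> Q" "snd ` set ps \<subseteq> V - Q"
        show False
          by (rule no_near_clique_with_three_pendants[OF PQ(2) 3 _ ps])
            (rule near(2)[OF QP cards(1) fin(2) x q])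
      qed simp
    qed
  next
    case 2
    obtain x where x: "x \<in> P" "card {y \<in> P. H x y} \<ge> 2"
      using no_dense_side[OF PQ 2(1)] by fastforce
    obtain y where y: "y \<in> Q" "card {u \<in> Q. H y u} \<ge> 2"
      using no_dense_side[OF PQ(2,1) QP 2(2)] by fastforce
    \<comment> \<open>A vertex with three \<open>H\<close>-neighbours inside \<open>P\<close> would
      leave at most one \<open>H\<close>-edge in \<open>Q\<close>, but \<open>y\<close> is on two of
      them.\<close>
    have P2: "card {u \<in> P. H z u} \<le> 2" if z: "z \<in> P" for z
    proof (rule ccontr)
      assume "\<not> ?thesis"
      then have "card {u \<in> P. H z u} \<ge> 3" by simp
      from near(1)[OF QP cards(1) fin(2) z this y(1)] y(2) show False by simp
    qed
    show False
    proof (rule pendants_exist[OF PQ 2(1)])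
      fix ps assume ps: "matching E ps" "length ps = 2" "fst ` set ps \<subseteq> P" "snd ` set ps \<subseteq> V - P"
      obtain q1 where q1: "q1 \<in> Q" "H y q1"
        using ex_notin[of "{}" "{u \<in> Q. H y u}"] y(2) by auto
      obtain q2 where q2: "q2 \<in> Q" "H y q2" "q1 \<noteq> q2"
        using ex_notin[of "{q1}" "{u \<in> Q. H y u}"] y(2) by auto
      have J: "joined {y, q1, q2} P" using QP y(1) q1(1) q2(1) by blast
      obtain c f a g b d where "{c, f, a, g, b, d} \<subseteq> P" "distinct [c, f, a, g, b, d]"
        "H c f" "H f a" "H a g" "H b d"
        by (rule spider_or_path_and_edge[OF PQ(1) 2(1) P2 ps])
      then show False by (rule wheel_from_path_and_edge[OF q1(2) q2(2,3) J])
    qed simp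
  qed
qed

text \<open>By \<open>inner_degree\<close> all \<open>H\<close>-degrees inside \<open>P\<close> and
  inside \<open>Q\<close> are at most 3, so \<open>no_dense_set\<close> keeps both sets below
  \<open>n\<close> vertices, and the larger one can play the part of \<open>P\<close> in
  \<open>no_joined_sides\<close>.\<close>

lemma no_joined_pair:
  assumes PQ: "P \<subseteq> V" "Q \<subseteq> V" "joined P Q" and sizes: "card P + card Q + 4 \<ge> 2 * n"
    and four: "card P \<ge> 4" "card Q \<ge> 4"
  shows False
proof -
  have QP: "joined Q P" using PQ(3) by (rule joined_sym)
  have dP: "card {y \<in> P. H x y} \<le> 3" if "x \<in> P" for x using inner_degree[OF QP four(2) that] .
  have dQ: "card {y \<in> Q. H x y} \<le> 3" if "x \<in> Q" for x using inner_degree[OF PQ(3) four(1) that] .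
  have "card P < n" "card Q < n"
    using no_dense_set[OF PQ(1) _ dP] no_dense_set[OF PQ(2) _ dQ] by fastforce+
  then show False
    using no_joined_sides[OF PQ sizes _ _ dP dQ] no_joined_sides[OF PQ(2,1) QP _ _ _ dQ dP] sizes
    by linarith
qed

end

section \<open>A vertex of large degree\<close>

text \<open>The non-neighbours \<open>M\<close> of a vertex \<open>p\<close> form a clique, hence
  number at most three. Without a 4-cycle, any vertex other than \<open>p\<close> has at most one
  neighbour in the neighbourhood \<open>N\<close> of \<open>p\<close>. This forces
  \<open>card N = 3\<close> and \<open>card M \<ge> 3\<close>, and all of \<open>M\<close> has one
  common neighbour in \<open>N\<close>, which closes a 4-cycle.\<close>

lemma four_cycle_if_no_independent_triple:
  assumes D: "card D \<ge> 7" and sym: "\<And>x y. R x y \<Longrightarrow> R y x"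
    and triple: "\<And>x y z. {x, y, z} \<subseteq> D \<Longrightarrow> distinct [x, y, z] \<Longrightarrow> R x y \<or> R y z \<or> R x z"
  shows "\<exists>a b c d. distinct [a, b, c, d] \<and> {a, b, c, d} \<subseteq> D \<and> R a b \<and> R b c \<and> R c d \<and> R d a"
proof (rule ccontr)
  assume "\<not> ?thesis"
  then have no4: False if "distinct [a, b, c, d]" "{a, b, c, d} \<subseteq> D" "R a b" "R b c" "R c d" "R d a"
    for a b c d using that by blast
  obtain p where p: "p \<in> D" using D by fastforce
  have finD: "finite D" using D by (metis card.infinite not_numeral_le_zero)
  define N where "N = {x \<in> D - {p}. R p x}"
  define M where "M = {x \<in> D - {p}. \<not> R p x}"
  have fin: "finite N" "finite M" using finD unfolding N_def M_def by auto
  have "card (D - {p}) = card N + card M"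
    unfolding N_def M_def using finD by (intro card_split) simp
  then have NM: "card N + card M \<ge> 6" using D p finD by simp
  have clique: "R a b" if "a \<in> M" "b \<in> M" "a \<noteq> b" for a b
    using triple[of p a b] that p unfolding M_def by auto
  have "card M < 4"
  proof (rule ccontr)
    assume "\<not> card M < 4"
    then have "4 \<le> card M" by simp
    then obtain a b c d where m: "distinct [a, b, c, d]" "{a, b, c, d} \<subseteq> M" by (rule obtain_four)
    have "{a, b, c, d} \<subseteq> D" using m(2) unfolding M_def by blast
    moreover have "R a b" "R b c" "R c d" "R d a" using m by (auto intro!: clique)
    ultimately show False using no4 m(1) by blast
  qed
  then have N3: "card N \<ge> 3" using NM by simp
  have one: "\<not> (R q r \<and> R q s)" if "q \<in> D" "q \<noteq> p" "r \<in> N" "s \<in> N" "r \<noteq> s" "q \<noteq> r" "q \<noteq> s" for q r s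
    using no4[of q r p s] that sym p unfolding N_def by auto
  have nonadj: "R r s" if "q \<in> D" "r \<in> N" "s \<in> N" "distinct [q, r, s]" "\<not> R q r" "\<not> R q s" for q r s
    using triple[of q r s] that unfolding N_def by auto
  \<comment> \<open>Three non-neighbours of \<open>q\<close> in \<open>N\<close> form a triangle, so
    \<open>a\<close> would have two neighbours in \<open>N\<close>.\<close>
  have two: False if q: "q \<in> D" "q \<noteq> p" and abc: "{a, b, c} \<subseteq> N - {q}" "distinct [a, b, c]"
    "\<not> R q a" "\<not> R q b" "\<not> R q c" for q a b c
    using nonadj[of q a b] nonadj[of q a c] one[of a b c] that unfolding N_def by auto
  have few: "card {x \<in> N - {q}. \<not> R q x} \<le> 2" if q: "q \<in> D" "q \<noteq> p" for q
  proof (rule ccontr)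
    assume "\<not> ?thesis"
    then have c: "card {x \<in> N - {q}. \<not> R q x} \<ge> 3" by simp
    obtain a where a: "a \<in> {x \<in> N - {q}. \<not> R q x}"
      using ex_notin[of "{}" "{x \<in> N - {q}. \<not> R q x}"] c by auto
    obtain b where b: "b \<in> {x \<in> N - {q}. \<not> R q x}" "b \<notin> {a}"
      using ex_notin[of "{a}" "{x \<in> N - {q}. \<not> R q x}"] c by auto
    obtain d where d: "d \<in> {x \<in> N - {q}. \<not> R q x}" "d \<notin> {a, b}"
      using ex_notin[of "{a, b}" "{x \<in> N - {q}. \<not> R q x}"] c b by auto
    show False using two[OF q, of a b d] a b d by auto
  qed
  have atmost: "card {x \<in> N - {q}. R q x} \<le> 1" if q: "q \<in> D" "q \<noteq> p" for q
    using one[OF q] fin by (intro at_most_one) auto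
  have small: "card (N - {q}) \<le> 3" if q: "q \<in> D" "q \<noteq> p" for q
    using few[OF q] atmost[OF q] card_split[of "N - {q}" "R q"] fin by simp
  have "card N \<le> 4"
  proof -
    obtain r where "r \<in> N" using ex_notin[of "{}" N] N3 by auto
    then show ?thesis using small[of r] fin unfolding N_def by auto
  qed
  then obtain q1 where q1: "q1 \<in> M" using ex_notin[of "{}" M] NM by auto
  then have "card N = 3" using small[of q1] N3 unfolding M_def N_def by auto
  then have M3: "card M \<ge> 3" using NM by simp
  obtain q2 where q2: "q2 \<in> M" "q2 \<noteq> q1" using ex_notin[of "{q1}" M] M3 by auto
  obtain q3 where q3: "q3 \<in> M" "q3 \<noteq> q1" "q3 \<noteq> q2" using ex_notin[of "{q1, q2}" M] M3 q2 by auto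
  have MN: "M \<inter> N = {}" unfolding M_def N_def by blast
  have ex: "\<exists>r\<in>N. R q r" if q: "q \<in> M" for q
  proof (rule ccontr)
    assume no: "\<not> ?thesis"
    have "{x \<in> N - {q}. \<not> R q x} = N" using no q MN by blast
    then show False using few[of q] q \<open>card N = 3\<close> unfolding M_def by auto
  qed
  have same: "r = s" if q: "q \<in> M" "q' \<in> M" "q \<noteq> q'" and rs: "r \<in> N" "s \<in> N" "R q r" "R q' s" for q q' r s
  proof (rule ccontr)
    assume ne: "r \<noteq> s"
    \<comment> \<open>The third vertex \<open>u\<close> of \<open>N\<close> is adjacent to
      \<open>r\<close> and to \<open>s\<close>, as \<open>q'\<close> and \<open>q\<close> have no
      second neighbour in \<open>N\<close>. So \<open>u\<close> violates \<open>one\<close>.\<close>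
    obtain u where u: "u \<in> N" "u \<noteq> r" "u \<noteq> s"
      using ex_notin[of "{r, s}" N] \<open>card N = 3\<close> ne by auto
    have qD: "q \<in> D" "q \<noteq> p" "q' \<in> D" "q' \<noteq> p" using q unfolding M_def by auto
    have d: "q \<noteq> r" "q \<noteq> s" "q \<noteq> u" "q' \<noteq> r" "q' \<noteq> s" "q' \<noteq> u" using q rs u MN by auto
    have "\<not> R q s" "\<not> R q u" using one[of q r s] one[of q r u] qD d rs u ne by auto
    then have su: "R s u" using nonadj[of q s u] qD d rs u by auto
    have "\<not> R q' r" "\<not> R q' u" using one[of q' s r] one[of q' s u] qD d rs u ne by auto
    then have ru: "R r u" using nonadj[of q' r u] qD d rs u by auto
    have "u \<in> D" "u \<noteq> p" using u unfolding N_def by auto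
    then show False using one[of u s r] su ru sym u rs ne by auto
  qed
  obtain r where r: "r \<in> N" "R q1 r" using ex[OF q1] by blast
  obtain s where s: "s \<in> N" "R q2 s" using ex[OF q2(1)] by blast
  have "r = s" using same[OF q1 q2(1) _ r(1) s(1) r(2) s(2)] q2(2) by simp
  then have "R q2 r" using s by simp
  moreover have "R q2 q3" "R q3 q1" using clique q1 q2 q3 by auto
  moreover have "{q1, r, q2, q3} \<subseteq> D" using q1 q2 q3 r unfolding M_def N_def by auto
  moreover have "distinct [q1, r, q2, q3]" using q1 q2 q3 r MN by auto
  ultimately show False using no4[of q1 r q2 q3] r(2) sym by blast
qed

context counterexample
begin

section \<open>Counting common \<open>H\<close>-neighbours\<close>

lemma degree_sum:
  assumes "x \<in> V"
  shows "card {y \<in> V. H x y} + card {y \<in> V. E x y} + 2 = 2 * n"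
proof -
  have "card (V - {x}) = card {y \<in> V - {x}. E x y} + card {y \<in> V - {x}. \<not> E x y}"
    using finite_V by (intro card_split) simp
  moreover have "{y \<in> V - {x}. E x y} = {y \<in> V. E x y}" using irrefl by blast
  moreover have "{y \<in> V - {x}. \<not> E x y} = {y \<in> V. H x y}" using assms unfolding nonadj_def by blast
  moreover have "card (V - {x}) = 2 * n - 2" using assms card_V by simp
  ultimately show ?thesis using n by simp
qed

text \<open>Two vertices are not among their own common \<open>H\<close>-neighbours, so removing
  \<open>x1\<close> to \<open>x4\<close> costs at most two of the six and leaves the four that
  \<open>wheel_from_common\<close> asks for.\<close>

lemma wheel_from_codegrees:
  assumes x: "distinct [x1, x2, x3, x4]" "{x1, x2, x3, x4} \<subseteq> A" and A: "A = {y \<in> V. H v y}"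
    and c: "card {z \<in> A. H x1 z \<and> H x2 z} \<ge> 6" "card {z \<in> A. H x2 z \<and> H x3 z} \<ge> 6"
      "card {z \<in> A. H x3 z \<and> H x4 z} \<ge> 6" "card {z \<in> A. H x4 z \<and> H x1 z} \<ge> 6"
  shows False
proof -
  have four: "4 \<le> card ({z \<in> A. H x z \<and> H y z} - {x1, x2, x3, x4})"
    if xy: "card {z \<in> A. H x z \<and> H y z} \<ge> 6" "{x1, x2, x3, x4} = {x, y, s, t}" for x y s t
  proof -
    have "{z \<in> A. H x z \<and> H y z} - {x1, x2, x3, x4} = {z \<in> A. H x z \<and> H y z} - {s, t}"
      using xy(2) by auto
    moreover have "card {z \<in> A. H x z \<and> H y z} - card {s, t} \<le> card ({z \<in> A. H x z \<and> H y z} - {s, t})"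
      by (rule diff_card_le_card_Diff) simp
    moreover have "card {s, t} \<le> 2" by (simp add: card_insert_if)
    ultimately show ?thesis using xy(1) by simp
  qed
  note cs = four[OF c(1), of x3 x4] four[OF c(2), of x4 x1] four[OF c(3), of x1 x2] four[OF c(4), of x2 x3]
  have h: "H v x1" "H v x2" "H v x3" "H v x4" using x(2) A by auto
  show False
    by (rule wheel_from_common[OF x(1) h,
      of "{z \<in> A. H x1 z \<and> H x2 z} - {x1, x2, x3, x4}" "{z \<in> A. H x2 z \<and> H x3 z} - {x1, x2, x3, x4}"
         "{z \<in> A. H x3 z \<and> H x4 z} - {x1, x2, x3, x4}" "{z \<in> A. H x4 z \<and> H x1 z} - {x1, x2, x3, x4}"])
      (use cs A in \<open>auto simp: insert_commute\<close>)
qed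

text \<open>Let \<open>A\<close> be the set of non-neighbours of a vertex \<open>v\<close> and let \<open>u \<in> A\<close> have the fewest
  non-neighbours in \<open>A\<close>. Each of them has either many common non-neighbours with \<open>u\<close> outside \<open>A\<close> or
  many non-neighbours in \<open>A\<close>. In the first case there is a wheel with hub \<open>u\<close>, in the second case
  one with hub \<open>v\<close>.\<close>

lemma large_degree_exists: "\<exists>x\<in>V. n \<le> card {y \<in> V. E x y} + 5"
proof (rule ccontr)
  assume "\<not> ?thesis"
  then have Edeg: "card {y \<in> V. E x y} + 6 \<le> n" if "x \<in> V" for x using that by force
  have Hdeg: "card {y \<in> V. H x y} \<ge> n + 4" if "x \<in> V" for x
    using degree_sum[OF that] Edeg[OF that] by linarith
  have "V \<noteq> {}" using card_V n by auto
  then obtain v where v: "v \<in> V" by blast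
  define A where "A = {y \<in> V. H v y}"
  define B where "B = {y \<in> V. E v y}"
  have fin: "finite A" "finite B" unfolding A_def B_def by auto
  have AB: "card A + card B + 2 = 2 * n" unfolding A_def B_def by (rule degree_sum[OF v])
  have cA: "card A \<ge> n + 4" unfolding A_def by (rule Hdeg[OF v])
  have disj: "A \<inter> B = {}" "v \<notin> A" "v \<notin> B" unfolding A_def B_def using irrefl by (auto simp: nonadj_def)
  have split: "card {y \<in> A. H x y} + card {y \<in> B. H x y} + 1 \<ge> n + 4" if x: "x \<in> A" for x
  proof -
    have "{y \<in> V. H x y} \<subseteq> insert v ({y \<in> A. H x y} \<union> {y \<in> B. H x y})"
      using v E_iff[of v] unfolding A_def B_def by blast
    then have "card {y \<in> V. H x y} \<le> card (insert v ({y \<in> A. H x y} \<union> {y \<in> B. H x y}))"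
      using fin by (intro card_mono) auto
    also have "\<dots> \<le> Suc (card ({y \<in> A. H x y} \<union> {y \<in> B. H x y}))" by (rule card_insert_le_m1) auto
    also have "\<dots> \<le> Suc (card {y \<in> A. H x y} + card {y \<in> B. H x y})" by (simp add: card_Un_le)
    finally show ?thesis using Hdeg[of x] x unfolding A_def by auto
  qed
  have "A \<noteq> {}" using cA by auto
  then obtain u where u: "u \<in> A" and min: "\<And>x. x \<in> A \<Longrightarrow> card {y \<in> A. H u y} \<le> card {y \<in> A. H x y}"
    using ex_is_arg_min_if_finite[OF fin(1), of "\<lambda>x. card {y \<in> A. H x y}"] unfolding is_arg_min_linorder by blast
  define D where "D = {y \<in> A. H u y}"
  define Y where "Y = {y \<in> B. H u y}"
  define t where "t = card D"
  have finDY: "finite D" "finite Y" "Y \<subseteq> B" using fin unfolding D_def Y_def by auto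
  have tY: "t + card Y \<ge> n + 3" using split[OF u] unfolding t_def D_def Y_def by linarith
  have YB: "card Y \<le> card B" using finDY fin by (intro card_mono) auto
  have t9: "t \<ge> 9" using tY YB AB cA by linarith
  \<comment> \<open>Two vertices of \<open>D1\<close> share at least three
    \<open>H\<close>-neighbours in \<open>Y\<close>, and \<open>v\<close> is a fourth one outside
    \<open>A\<close>. So four vertices of \<open>D1\<close> give a wheel with hub
    \<open>u\<close>.\<close>
  define D1 where "D1 = {x \<in> D. card Y + 3 \<le> 2 * card {y \<in> Y. H x y}}"
  have D1: "card D1 < 4"
  proof (rule ccontr)
    assume "\<not> ?thesis"
    then have "4 \<le> card D1" by simp
    then obtain x1 x2 x3 x4 where x: "distinct [x1, x2, x3, x4]" "{x1, x2, x3, x4} \<subseteq> D1"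
      by (rule obtain_four)
    define C where "C = (\<lambda>x y. insert v {z \<in> Y. H x z \<and> H y z})"
    have cC: "4 \<le> card (C x y)" if "x \<in> D1" "y \<in> D1" for x y
    proof -
      have "card {z \<in> Y. H x z} + card {z \<in> Y. H y z} \<le> card Y + card ({z \<in> Y. H x z} \<inter> {z \<in> Y. H y z})"
        using finDY by (intro card_le_Un) auto
      moreover have "{z \<in> Y. H x z} \<inter> {z \<in> Y. H y z} = {z \<in> Y. H x z \<and> H y z}" by blast
      ultimately have "3 \<le> card {z \<in> Y. H x z \<and> H y z}" using that unfolding D1_def by auto
      moreover have "v \<notin> Y" using disj finDY by blast
      ultimately show ?thesis using finDY unfolding C_def by simp
    qed
    have D1A: "H u x" "H x v" "x \<in> A" if "x \<in> D1" for x
      using that H_sym unfolding D1_def D_def A_def by blast+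
    have uv: "H u v" using u H_sym unfolding A_def by blast
    have CH: "H u z \<and> H x z \<and> H y z" if "z \<in> C x y" "x \<in> D1" "y \<in> D1" for x y z
      using that D1A uv unfolding C_def Y_def by blast
    have CA: "C x y \<inter> A = {}" for x y using disj finDY unfolding C_def by blast
    have xs: "x1 \<in> D1" "x2 \<in> D1" "x3 \<in> D1" "x4 \<in> D1" using x(2) by auto
    show False
    proof (rule wheel_from_common[OF x(1), of u "C x1 x2" "C x2 x3" "C x3 x4" "C x4 x1"])
      show "{x1, x2, x3, x4} \<inter> (C x1 x2 \<union> C x2 x3 \<union> C x3 x4 \<union> C x4 x1) = {}"
        using CA D1A(3) xs by blast
      show "3 \<le> card (C x3 x4)" "3 \<le> card (C x4 x1)"
        using cC[of x3 x4] cC[of x4 x1] xs by simp_all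
    qed (use D1A(1) CH cC xs in blast)+
  qed
  define D2 where "D2 = D - D1"
  have "card D2 = t - card D1"
    using finDY unfolding D2_def t_def D1_def by (subst card_Diff_subset) auto
  then have cD2: "card D2 + 3 \<ge> t" using D1 by linarith
  have g: "2 * card {y \<in> A. H x y} + t + n \<ge> 2 * card A + 11" if x: "x \<in> D2" for x
  proof -
    have xA: "x \<in> A" using x unfolding D2_def D_def by blast
    have "{y \<in> B. H x y} \<subseteq> {y \<in> Y. H x y} \<union> (B - Y)" by blast
    then have "card {y \<in> B. H x y} \<le> card ({y \<in> Y. H x y} \<union> (B - Y))"
      using fin finDY by (intro card_mono) auto
    also have "\<dots> \<le> card {y \<in> Y. H x y} + card (B - Y)" by (rule card_Un_le)
    also have "card (B - Y) = card B - card Y" using fin finDY by (simp add: card_Diff_subset)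
    finally have "card {y \<in> B. H x y} + card Y \<le> card {y \<in> Y. H x y} + card B" using YB by linarith
    moreover have "2 * card {y \<in> Y. H x y} \<le> card Y + 2" using x unfolding D2_def D1_def by auto
    ultimately show ?thesis using split[OF xA] tY AB by linarith
  qed
  \<comment> \<open>The choice of \<open>u\<close> makes \<open>t\<close> at most the number of
    \<open>H\<close>-neighbours of \<open>x\<close> in \<open>A\<close>, which eliminates
    \<open>t\<close> from \<open>g\<close>.\<close>
  have gt: "3 * card {y \<in> A. H x y} \<ge> card A + 15" if x: "x \<in> D2" for x
  proof -
    have "t \<le> card {y \<in> A. H x y}"
      unfolding t_def D_def using x by (intro min) (auto simp: D2_def D_def)
    then show ?thesis using g[OF x] cA by linarith
  qed
  \<comment> \<open>Six is the number required by \<open>wheel_from_codegrees\<close>, so a 4-cycle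
    of \<open>R\<close> gives a wheel with hub \<open>v\<close>.\<close>
  define R where "R = (\<lambda>x y. card {z \<in> A. H x z \<and> H y z} \<ge> 6)"
  have D2A: "D2 \<subseteq> A" unfolding D2_def D_def by blast
  have "\<exists>a b c d. distinct [a, b, c, d] \<and> {a, b, c, d} \<subseteq> D2 \<and> R a b \<and> R b c \<and> R c d \<and> R d a"
  proof (cases "card D2 \<ge> 7")
    case True
    then show ?thesis
    proof (rule four_cycle_if_no_independent_triple)
      show "R y x" if "R x y" for x y
        using that unfolding R_def by (simp add: conj_commute)
      \<comment> \<open>Inclusion-exclusion: the three neighbourhoods have sizes summing to at least
        \<open>card A + 15\<close>, pairwise intersections of at most five elements and the common
        element \<open>u\<close>, so their union would exceed \<open>A\<close>.\<close>
      show "R x y \<or> R y z \<or> R x z" if xyz: "{x, y, z} \<subseteq> D2" "distinct [x, y, z]" for x y z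
      proof (rule ccontr)
        assume neg: "\<not> ?thesis"
        define N where "N = (\<lambda>x. {w \<in> A. H x w})"
        have finN: "finite (N a)" for a unfolding N_def using fin by simp
        have R: "R a b \<longleftrightarrow> card (N a \<inter> N b) \<ge> 6" for a b
        proof -
          have "N a \<inter> N b = {z \<in> A. H a z \<and> H b z}" unfolding N_def by blast
          then show ?thesis unfolding R_def by simp
        qed
        have uN: "u \<in> (N x \<inter> N z) \<inter> (N y \<inter> N z)"
          using u xyz H_sym unfolding N_def D2_def D_def by blast
        have "card (N x) + card (N y) = card (N x \<union> N y) + card (N x \<inter> N y)"
          using finN by (intro card_Un_Int)
        moreover have "card (N x \<union> N y) + card (N z) =
            card (N x \<union> N y \<union> N z) + card ((N x \<inter> N z) \<union> (N y \<inter> N z))"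
          using card_Un_Int[of "N x \<union> N y" "N z"] finN by (simp add: Int_Un_distrib2)
        moreover have "card (N x \<inter> N z) + card (N y \<inter> N z) =
            card ((N x \<inter> N z) \<union> (N y \<inter> N z)) + card ((N x \<inter> N z) \<inter> (N y \<inter> N z))"
          using finN by (intro card_Un_Int) auto
        moreover have "card ((N x \<inter> N z) \<inter> (N y \<inter> N z)) \<ge> 1"
          using uN finN card_0_eq[of "(N x \<inter> N z) \<inter> (N y \<inter> N z)"] by fastforce
        moreover have "card (N x \<union> N y \<union> N z) \<le> card A"
          using fin unfolding N_def by (intro card_mono) auto
        moreover have "card (N x \<inter> N y) \<le> 5" "card (N x \<inter> N z) \<le> 5" "card (N y \<inter> N z) \<le> 5"
          using neg unfolding R by auto
        moreover have "3 * card (N x) \<ge> card A + 15" "3 * card (N y) \<ge> card A + 15" "3 * card (N z) \<ge> card A + 15"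
          using gt xyz unfolding N_def by auto
        ultimately show False by linarith
      qed
    qed
  next
    case False
    \<comment> \<open>For this small \<open>t\<close> the bound \<open>g\<close> alone gives any two
      vertices of \<open>D2\<close> six common \<open>H\<close>-neighbours in
      \<open>A\<close>.\<close>
    then have "t = 9" using cD2 t9 by linarith
    have "4 \<le> card D2" using cD2 t9 by linarith
    then obtain a b c d where abcd: "distinct [a, b, c, d]" "{a, b, c, d} \<subseteq> D2" by (rule obtain_four)
    have "R x y" if "x \<in> D2" "y \<in> D2" for x y
    proof -
      have "card {z \<in> A. H x z} + card {z \<in> A. H y z} \<le> card A + card ({z \<in> A. H x z} \<inter> {z \<in> A. H y z})"
        using fin by (intro card_le_Un) auto
      moreover have "{z \<in> A. H x z} \<inter> {z \<in> A. H y z} = {z \<in> A. H x z \<and> H y z}" by blast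
      ultimately show ?thesis using g[OF that(1)] g[OF that(2)] \<open>t = 9\<close> cA unfolding R_def by simp
    qed
    then show ?thesis using abcd by blast
  qed
  then obtain a b c d where abcd: "distinct [a, b, c, d]" "{a, b, c, d} \<subseteq> D2" "R a b" "R b c" "R c d" "R d a"
    by blast
  show False
    using wheel_from_codegrees[OF abcd(1) _ A_def] abcd(2-) D2A unfolding R_def by blast
qed

end

section \<open>A vertex of maximum degree\<close>

context counterexample
begin

section \<open>Sets of bounded \<open>G\<close>-degree joined to three vertices\<close>

lemma H_nbrs_ge:
  assumes "w \<in> V" "X \<subseteq> V - {w}"
  shows "card X \<le> card {z \<in> X. H w z} + card {z \<in> X. E w z}"
proof -
  have "finite X" using assms(2) fin by blast
  have "{z \<in> X. \<not> H w z} \<subseteq> {z \<in> X. E w z}" using assms E_iff[of w] by blast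
  then have "card {z \<in> X. \<not> H w z} \<le> card {z \<in> X. E w z}" using \<open>finite X\<close> by (intro card_mono) auto
  then show ?thesis using card_split[OF \<open>finite X\<close>, of "H w"] by simp
qed

lemma card_common:
  assumes "x \<in> V" "y \<in> V" "X \<subseteq> V - {x, y}"
  shows "card X \<le> card {z \<in> X. H x z \<and> H y z} + card {z \<in> X. E x z} + card {z \<in> X. E y z}"
proof -
  have finO: "finite X" using assms(3) fin by blast
  have "X \<subseteq> {z \<in> X. H x z \<and> H y z} \<union> ({z \<in> X. E x z} \<union> {z \<in> X. E y z})"
    using assms E_iff[of x] E_iff[of y] by blast
  then have "card X \<le> card ({z \<in> X. H x z \<and> H y z} \<union> ({z \<in> X. E x z} \<union> {z \<in> X. E y z}))"
    using finO by (intro card_mono) auto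
  also have "\<dots> \<le> card {z \<in> X. H x z \<and> H y z} + card ({z \<in> X. E x z} \<union> {z \<in> X. E y z})"
    by (rule card_Un_le)
  also have "\<dots> \<le> card {z \<in> X. H x z \<and> H y z} + (card {z \<in> X. E x z} + card {z \<in> X. E y z})"
    by (intro add_left_mono card_Un_le)
  finally show ?thesis by simp
qed

text \<open>Some \<open>w\<close> in \<open>W\<close> has five \<open>H\<close>-neighbours
  \<open>F\<close> in \<open>W\<close>, and hub \<open>w\<close> allows at most one
  \<open>H\<close>-edge in \<open>F\<close>. So vertices of \<open>F\<close> spend most of their
  five \<open>G\<close>-edges inside \<open>F\<close>, and four of them have enough common
  \<open>H\<close>-neighbours in \<open>W - F\<close> for a wheel with hub
  \<open>x1\<close>.\<close>

lemma no_three_joined: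
  assumes x: "distinct [x1, x2, x3]" and W: "W \<subseteq> V" "joined {x1, x2, x3} W" "card W \<ge> 11"
    and deg: "\<And>w. w \<in> W \<Longrightarrow> card {y \<in> W. E w y} \<le> 5"
  shows False
proof -
  obtain w where w: "w \<in> W" using ex_notin[of "{}" W] W(3) by auto
  have finW: "finite W" using W(1) by (rule fin)
  have "card (W - {w}) \<le> card {z \<in> W - {w}. H w z} + card {z \<in> W - {w}. E w z}"
    using W(1) w by (intro H_nbrs_ge) auto
  moreover have "{z \<in> W - {w}. E w z} = {z \<in> W. E w z}" using irrefl by blast
  ultimately have "5 \<le> card {z \<in> W - {w}. H w z}" using deg[OF w] W(3) w finW by simp
  then obtain F where F: "F \<subseteq> {z \<in> W - {w}. H w z}" "card F = 5"
    by (meson obtain_subset_with_card_n)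
  have FW: "F \<subseteq> W" using F(1) by blast
  have finF: "finite F" using FW finW by (rule finite_subset)
  have one: "{a, b} = {c, d}" if "a \<in> F" "b \<in> F" "c \<in> F" "d \<in> F" "H a b" "H c d" for a b c d
  proof (rule ccontr)
    assume ne: "{a, b} \<noteq> {c, d}"
    show False
    proof (rule wheel_from_three[OF x _ _ _ _ _ _ that ne])
      show "H w x1" "H w x2" "H w x3" using W(2) w H_sym[of _ w] by simp_all
      show "joined {x1, x2, x3} F" using W(2) FW by blast
      show "H w p" if "p \<in> F" for p using that F(1) by blast
    qed (use F(2) in simp)
  qed
  obtain y1 y2 y3 y4 where y: "distinct [y1, y2, y3, y4]" "{y1, y2, y3, y4} \<subseteq> F"
    and isolated: "\<And>y z. y \<in> {y1, y2, y3} \<Longrightarrow> z \<in> F \<Longrightarrow> \<not> H y z"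
  proof (cases "\<exists>a\<in>F. \<exists>b\<in>F. H a b")
    case True
    then obtain a b where ab: "a \<in> F" "b \<in> F" "H a b" by blast
    have ne: "a \<noteq> b" using ab(3) by (rule H_neq)
    have c3: "card (F - {a, b}) = 3" using ab ne F(2) finF by simp
    obtain y1 where y1: "y1 \<in> F - {a, b}" using ex_notin[of "{}" "F - {a, b}"] c3 by auto
    obtain y2 where y2: "y2 \<in> F - {a, b}" "y2 \<noteq> y1" using ex_notin[of "{y1}" "F - {a, b}"] c3 by auto
    obtain y3 where y3: "y3 \<in> F - {a, b}" "y3 \<noteq> y1" "y3 \<noteq> y2"
      using ex_notin[of "{y1, y2}" "F - {a, b}"] c3 y2 by auto
    have "\<not> H y z" if yz: "y \<in> {y1, y2, y3}" "z \<in> F" for y z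
    proof
      assume "H y z"
      moreover have "y \<in> F" "y \<notin> {a, b}" using yz y1 y2 y3 by auto
      ultimately show False using one[OF _ yz(2) ab(1,2) _ ab(3)] by blast
    qed
    then show thesis using that[of y1 y2 y3 a] y1 y2 y3 ab by auto
  next
    case False
    have "4 \<le> card F" using F(2) by simp
    then obtain y1 y2 y3 y4 where "distinct [y1, y2, y3, y4]" "{y1, y2, y3, y4} \<subseteq> F"
      by (rule obtain_four)
    then show thesis using that[of y1 y2 y3 y4] False by blast
  qed
  define O' where "O' = W - F"
  have cO: "card O' \<ge> 6" using FW F(2) W(3) finF unfolding O'_def by (simp add: card_Diff_subset)
  \<comment> \<open>This leaves \<open>y1\<close>, \<open>y2\<close>, \<open>y3\<close> at most one
    \<open>G\<close>-neighbour in \<open>O'\<close> each, and \<open>y4\<close> at most two.\<close>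
  have out: "card {z \<in> O'. E y z} + 4 \<le> 5 + card {z \<in> F. H y z}" if yF: "y \<in> F" for y
  proof -
    have "card (F - {y}) \<le> card {z \<in> F - {y}. H y z} + card {z \<in> F - {y}. E y z}"
      using yF FW W(1) by (intro H_nbrs_ge) auto
    moreover have "{z \<in> F - {y}. H y z} = {z \<in> F. H y z}" by auto
    moreover have "{z \<in> F - {y}. E y z} = {z \<in> F. E y z}" using irrefl by blast
    moreover have "card {z \<in> W. E y z} = card {z \<in> O'. E y z} + card {z \<in> F. E y z}"
    proof -
      have "{z \<in> W. E y z} = {z \<in> O'. E y z} \<union> {z \<in> F. E y z}" using FW unfolding O'_def by blast
      then show ?thesis using finW finF by (simp add: O'_def card_Un_disjoint disjoint_iff)
    qed
    ultimately show ?thesis using deg[of y] yF FW F(2) finF by auto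
  qed
  have yF: "y1 \<in> F" "y2 \<in> F" "y3 \<in> F" "y4 \<in> F" using y(2) by auto
  have "card {z \<in> F. H y4 z} \<le> 1"
  proof (rule at_most_one)
    fix a b assume "a \<in> {z \<in> F. H y4 z}" "b \<in> {z \<in> F. H y4 z}"
    then have "{y4, a} = {y4, b}" using one[OF yF(4) _ yF(4)] by blast
    then show "a = b" by (auto simp: doubleton_eq_iff)
  qed (use finF in simp)
  then have out4: "card {z \<in> O'. E y4 z} \<le> 2" using out[OF yF(4)] by simp
  have "card {z \<in> F. H y z} = 0" if "y \<in> {y1, y2, y3}" for y
  proof -
    have "{z \<in> F. H y z} = {}" using isolated[OF that] by blast
    then show ?thesis by (simp only: card.empty)
  qed
  from this[of y1] this[of y2] this[of y3] have out3: "card {z \<in> O'. E y1 z} \<le> 1" "card {z \<in> O'. E y2 z} \<le> 1" "card {z \<in> O'. E y3 z} \<le> 1"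
    using out[OF yF(1)] out[OF yF(2)] out[OF yF(3)] by auto
  define C where "C = (\<lambda>y y'. {z \<in> O'. H y z \<and> H y' z})"
  have cC: "card O' \<le> card (C y y') + card {z \<in> O'. E y z} + card {z \<in> O'. E y' z}"
    if "y \<in> F" "y' \<in> F" for y y'
    unfolding C_def using that FW W(1) by (intro card_common) (auto simp: O'_def)
  have h: "H x1 z" if "z \<in> W" for z using that W(2) by blast
  have hC: "H x1 z \<and> H y z \<and> H y' z" if "z \<in> C y y'" for z y y'
    using that h unfolding C_def O'_def by blast
  show False
  proof (rule wheel_from_common[OF y(1), of x1 "C y1 y2" "C y2 y3" "C y3 y4" "C y4 y1"])
    show "H x1 y1" "H x1 y2" "H x1 y3" "H x1 y4" using yF FW h by blast+
    show "{y1, y2, y3, y4} \<inter> (C y1 y2 \<union> C y2 y3 \<union> C y3 y4 \<union> C y4 y1) = {}"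
      using yF unfolding C_def O'_def by blast
    show "4 \<le> card (C y1 y2)" using cC[OF yF(1,2)] out3 cO by linarith
    show "4 \<le> card (C y2 y3)" using cC[OF yF(2,3)] out3 cO by linarith
    show "3 \<le> card (C y3 y4)" using cC[OF yF(3,4)] out3 out4 cO by linarith
    show "3 \<le> card (C y4 y1)" using cC[OF yF(4,1)] out3 out4 cO by linarith
  qed (use hC in blast)+
qed

section \<open>Matchings that start in the neighbourhood of a vertex\<close>

context
  fixes v U W
  assumes v: "v \<in> V" and U: "U = {y \<in> V. E v y}" and W: "W = {y \<in> V. H v y}"
begin

lemma UW: "card U + card W + 2 = 2 * n" "U \<inter> W = {}" "v \<notin> U" "v \<notin> W" "finite U" "finite W"
  "U \<subseteq> V" "W \<subseteq> V" "V = insert v (U \<union> W)"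
  using degree_sum[OF v] irrefl finite_V v E_iff[of v] unfolding U W by (auto simp: nonadj_def)

lemma spider_at:
  assumes "matching E ms" "length ms = 4" "fst ` set ms \<subseteq> U" "snd ` set ms \<subseteq> U \<union> W"
    "n \<le> card (U - cover ms) + 9"
  shows False
proof (rule no_spider[OF assms(2,1) _ v])
  show "cover ms \<subseteq> V - {v}" using assms(3,4) UW unfolding cover_def by blast
  show "\<forall>(a, b)\<in>set ms. E v a" using assms(3) unfolding U by force
  show "U - cover ms \<subseteq> V - cover ms" using UW(7) by blast
  show "\<forall>l\<in>U - cover ms. E v l" unfolding U by blast
  show "n - 9 \<le> card (U - cover ms)" using assms(5) by simp
qed

text \<open>The uncovered part \<open>I\<close> of \<open>U\<close> is joined in \<open>H\<close> to
  every other uncovered vertex, also within \<open>I\<close>. A hub and four more vertices from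
  \<open>I\<close> together with four other uncovered vertices form a wheel.\<close>

lemma stuck_matching:
  assumes ms: "matching E ms" "length ms \<le> 3" "fst ` set ms \<subseteq> U" "snd ` set ms \<subseteq> U \<union> W"
    and five: "card (U - cover ms) \<ge> 5"
    and stuck: "\<And>a b. a \<in> U - cover ms \<Longrightarrow> b \<in> U \<union> W - cover ms \<Longrightarrow> \<not> E a b"
  shows False
proof -
  define I where "I = U - cover ms"
  define J where "J = U \<union> W - cover ms"
  have IJ: "I \<subseteq> J" "J \<subseteq> V" "finite J" "finite I" using UW unfolding I_def J_def by blast+
  have "cover ms \<subseteq> U \<union> W" using ms(3,4) unfolding cover_def by blast
  then have "card J = card (U \<union> W) - 2 * length ms"
    using card_cover[OF ms(1)] unfolding J_def by (simp add: card_Diff_subset)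
  moreover have "card (U \<union> W) = card U + card W" using UW by (intro card_Un_disjoint) auto
  ultimately have cJ: "card J \<ge> 10" using UW(1) ms(2) n by linarith
  have H: "H a b" if "a \<in> I" "b \<in> J" "a \<noteq> b" for a b
    using that stuck[of a b] IJ unfolding nonadj_def I_def J_def by blast
  obtain h where h: "h \<in> I" using ex_notin[of "{}" I] five unfolding I_def by auto
  have "4 \<le> card (I - {h})" using five h IJ unfolding I_def by simp
  then obtain A where A: "A \<subseteq> I - {h}" "card A = 4" by (meson obtain_subset_with_card_n)
  have finA: "finite A" using A(1) IJ finite_subset by blast
  have hA: "insert h A \<subseteq> J" "h \<notin> A" using A h IJ by blast+
  show False
  proof (rule wheel_from_bipartite[of A "J - insert h A" h])
    show "A \<inter> (J - insert h A) = {}" by blast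
    show "joined A (J - insert h A)" using H A(1) by blast
    show "H h x" if "x \<in> A \<union> (J - insert h A)" for x using H[OF h] that A(1) IJ by blast
    show "4 \<le> card A" using A(2) by simp
    have "card (J - insert h A) = card J - 5"
      using hA finA A(2) by (subst card_Diff_subset) auto
    then show "4 \<le> card (J - insert h A)" using cJ by simp
  qed
qed

lemma card_U_minus_cover:
  assumes "matching E ms"
  shows "card U \<le> card (U - cover ms) + 2 * length ms"
  using card_cover[OF assms] diff_card_le_card_Diff[OF finite_cover, of U ms] by linarith

text \<open>For a larger \<open>U\<close>, four disjoint edges starting in \<open>U\<close> spare
  enough leaves even if they lie inside \<open>U\<close>, and a maximal matching with fewer edges is
  excluded by \<open>stuck_matching\<close>.\<close>

lemma degree_le: "card U \<le> n + 1"
proof (rule ccontr)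
  assume big: "\<not> ?thesis"
  define Q where "Q = (\<lambda>ms. matching E ms \<and> fst ` set ms \<subseteq> U \<and> snd ` set ms \<subseteq> U \<union> W)"
  have bound: "length ms < 4" if Qms: "Q ms" for ms
  proof (rule ccontr)
    assume "\<not> length ms < 4"
    then have l: "length (take 4 ms) = 4" by simp
    have m: "matching E (take 4 ms)"
      using Qms matching_append[of E "take 4 ms" "drop 4 ms"] unfolding Q_def by simp
    show False
    proof (rule spider_at[OF m l])
      have "set (take 4 ms) \<subseteq> set ms" by (rule set_take_subset)
      then show "fst ` set (take 4 ms) \<subseteq> U" "snd ` set (take 4 ms) \<subseteq> U \<union> W"
        using Qms unfolding Q_def by blast+
      show "n \<le> card (U - cover (take 4 ms)) + 9" using card_U_minus_cover[OF m] l big by linarith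
    qed
  qed
  have "Q []" unfolding Q_def by simp
  then obtain ms where ms: "Q ms" and max: "\<And>ms'. Q ms' \<Longrightarrow> length ms' \<le> length ms"
    using ex_has_greatest_nat[of Q "[]" length 4] bound less_imp_le by metis
  have m: "matching E ms" "fst ` set ms \<subseteq> U" "snd ` set ms \<subseteq> U \<union> W" using ms unfolding Q_def by auto
  have l: "length ms \<le> 3" using bound[OF ms] by simp
  show False
  proof (rule stuck_matching[OF m(1) l m(2,3)])
    show "5 \<le> card (U - cover ms)" using card_U_minus_cover[OF m(1)] l big n by linarith
    show "\<not> E a b" if ab: "a \<in> U - cover ms" "b \<in> U \<union> W - cover ms" for a b
    proof
      assume "E a b"
      then have "Q ((a, b) # ms)" using ab m irrefl unfolding Q_def by auto
      then show False using max by fastforce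
    qed
  qed
qed

text \<open>Far ends in \<open>W\<close> cost no leaves, so four legs leave
  \<open>card U - 4\<close> of them. For \<open>k = 3\<close>, \<open>stuck_matching\<close>
  supplies a fourth leg, possibly inside \<open>U\<close>, which the larger \<open>U\<close> can
  afford.\<close>

lemma no_matching_to_W:
  assumes "n \<le> card U + 5"
    and ms: "matching E ms" "length ms = k" "fst ` set ms \<subseteq> U" "snd ` set ms \<subseteq> W"
    and k: "k = 4 \<or> k = 3 \<and> n \<le> card U + 1"
  shows False
proof -
  have leaves: "card (U - cover ms) = card U - k"
  proof -
    have "U - cover ms = U - fst ` set ms" using ms(4) UW(2) unfolding cover_def by blast
    then show ?thesis using ms(3) card_fst_matching[OF ms(1)] ms(2) by (simp add: card_Diff_subset)
  qed
  have snd: "snd ` set ms \<subseteq> U \<union> W" using ms(4) by blast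
  show False
  proof (cases "k = 4")
    case True
    have "n \<le> card (U - cover ms) + 9" using leaves assms(1) True by linarith
    then show ?thesis using spider_at[OF ms(1) _ ms(3) snd] ms(2) True by simp
  next
    case False
    then have k3: "k = 3" "n \<le> card U + 1" using k by auto
    show False
    proof (rule stuck_matching[OF ms(1) _ ms(3) snd])
      show "length ms \<le> 3" "5 \<le> card (U - cover ms)" using ms(2) k3 leaves n by simp_all
      show "\<not> E a b" if ab: "a \<in> U - cover ms" "b \<in> U \<union> W - cover ms" for a b
      proof
        assume "E a b"
        then have m: "matching E ((a, b) # ms)" using ab ms(1) irrefl by auto
        show False
          by (rule spider_at[OF m])
            (use ab ms k3 snd card_U_minus_cover[OF m] in auto)
      qed
    qed
  qed
qed

text \<open>The hub is a vertex \<open>w\<close> of \<open>W\<close> with no \<open>G\<close>-edge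
  to \<open>x1\<close>, \<open>x2\<close>, \<open>u\<close>. On the rim \<open>x1, v, x2, u\<close>
  alternate with \<open>H\<close>-neighbours of \<open>w\<close> in \<open>W\<close>:
  \<open>v\<close> and \<open>u\<close> are \<open>H\<close>-adjacent to all of these, and
  \<open>x1\<close>, \<open>x2\<close> to at least four each.\<close>

lemma small_star_case:
  assumes "card U = 4" "n = 9" and u: "u \<in> U" "\<And>b. b \<in> W \<Longrightarrow> \<not> E u b"
    and max: "\<And>x. x \<in> V \<Longrightarrow> card {y \<in> V. E x y} \<le> 4"
  shows False
proof -
  have cW: "card W = 12" using UW(1) assms by simp
  have degW: "card {z \<in> W. E x z} \<le> 3" if x: "x \<in> U" for x
  proof -
    have "E x v" using x sym unfolding U by blast
    then have "insert v {z \<in> W. E x z} \<subseteq> {y \<in> V. E x y}" using v UW(8) by blast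
    then have "card (insert v {z \<in> W. E x z}) \<le> card {y \<in> V. E x y}" by (intro card_mono) auto
    also have "\<dots> \<le> 4" using x UW(7) by (intro max) auto
    finally show ?thesis using UW(4,6) by simp
  qed
  obtain x1 where x1: "x1 \<in> U" "x1 \<noteq> u" using ex_notin[of "{u}" U] assms(1) by auto
  obtain x2 where x2: "x2 \<in> U" "x2 \<noteq> u" "x2 \<noteq> x1" using ex_notin[of "{u, x1}" U] assms(1) x1 by auto
  have "card ({z \<in> W. E x1 z} \<union> {z \<in> W. E x2 z}) \<le> 6"
    using degW[OF x1(1)] degW[OF x2(1)] card_Un_le[of "{z \<in> W. E x1 z}" "{z \<in> W. E x2 z}"] by linarith
  then obtain w where w: "w \<in> W" "\<not> E x1 w" "\<not> E x2 w"
    using ex_notin[of "{z \<in> W. E x1 z} \<union> {z \<in> W. E x2 z}" W] cW UW(6) by auto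
  define F where "F = {z \<in> W - {w}. H w z}"
  have "card (W - {w}) \<le> card F + card {z \<in> W - {w}. E w z}"
    unfolding F_def using w UW(8) by (intro H_nbrs_ge) auto
  moreover have "card {z \<in> W - {w}. E w z} \<le> card {y \<in> V. E w y}"
    using UW(8) by (intro card_mono) auto
  ultimately have cF: "card F \<ge> 7" using max[of w] w UW(6,8) cW by auto
  have FW: "F \<subseteq> W" unfolding F_def by blast
  have cC: "4 \<le> card {z \<in> F. H x z}" if x: "x \<in> U" for x
  proof -
    have "card F \<le> card {z \<in> F. H x z} + card {z \<in> F. E x z}"
      using x FW UW(2,7,8) by (intro H_nbrs_ge) auto
    moreover have "card {z \<in> F. E x z} \<le> card {z \<in> W. E x z}"
      using FW UW(6) by (intro card_mono) auto
    ultimately show ?thesis using cF degW[OF x] by linarith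
  qed
  have HU: "H x z" if "x \<in> U" "z \<in> W" "\<not> E x z" for x z
    using that UW(2,7,8) unfolding nonadj_def by blast
  have HuF: "H u z" "H v z" "H w z" if "z \<in> F" for z
    using that HU[OF u(1)] u(2) unfolding F_def W by blast+
  have dist: "distinct [x1, v, x2, u]" using x1 x2 u(1) UW(3) by auto
  show False
  proof (rule wheel_from_common[OF dist, of w "{z \<in> F. H x1 z}" "{z \<in> F. H x2 z}" "{z \<in> F. H x2 z}" "{z \<in> F. H x1 z}"])
    show "H w x1" "H w x2" "H w u" "H w v"
      using H_sym[OF HU[OF x1(1) w(1,2)]] H_sym[OF HU[OF x2(1) w(1,3)]]
        H_sym[OF HU[OF u(1) w(1) u(2)[OF w(1)]]] H_sym[of v w] w(1) unfolding W by blast+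
    show "{x1, v, x2, u} \<inter> ({z \<in> F. H x1 z} \<union> {z \<in> F. H x2 z} \<union> {z \<in> F. H x2 z} \<union> {z \<in> F. H x1 z}) = {}"
      using FW x1(1) x2(1) u(1) UW(2,4) by blast
    show "3 \<le> card {z \<in> F. H x1 z}" "3 \<le> card {z \<in> F. H x2 z}" using cC x1 x2 by fastforce+
  qed (use HuF cC x1(1) x2(1) in blast)+
qed

text \<open>The cover from Koenig's theorem makes \<open>insert v S\<close> and \<open>Q\<close>
  joined in \<open>H\<close>, with at least \<open>2n - 4\<close> vertices in total. This
  contradicts \<open>no_joined_pair\<close> unless \<open>card S \<le> 2\<close>; then
  \<open>card U \<le> 5\<close>, and the two remaining lemmas apply.\<close>

lemma no_max_degree_vertex:
  assumes large: "n \<le> card U + 5" and max: "\<And>x. x \<in> V \<Longrightarrow> card {y \<in> V. E x y} \<le> card U"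
  shows False
proof -
  \<comment> \<open>When \<open>card U\<close> is at least \<open>n - 1\<close>, three edges
    suffice, and the smaller \<open>k\<close> is what keeps four vertices in \<open>Q\<close> for
    \<open>card U\<close> up to \<open>n + 1\<close>.\<close>
  define k where "k = (if n \<le> card U + 1 then 3 else 4 :: nat)"
  show False
  proof (rule bipartite_matching_or_cover[OF UW(5,6,2), of E k])
    fix ms assume "matching E ms" "length ms = k" "fst ` set ms \<subseteq> U" "snd ` set ms \<subseteq> W"
    then show False by (rule no_matching_to_W[OF large]) (simp add: k_def)
  next
    fix S assume S: "S \<subseteq> U" "card {b \<in> W. \<exists>a\<in>S. E a b} + card (U - S) < k"
    define N where "N = {b \<in> W. \<exists>a\<in>S. E a b}"
    define Q where "Q = W - N"
    have finS: "finite S" using S(1) UW(5) finite_subset by blast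
    have cU: "card U = card S + card (U - S)"
      using S(1) UW(5) finS card_mono[OF UW(5) S(1)] by (simp add: card_Diff_subset)
    have NW: "N \<subseteq> W" unfolding N_def by blast
    have cW: "card W = card Q + card N"
      using UW(6) NW card_mono[OF UW(6) NW] finite_subset[OF NW UW(6)] unfolding Q_def by (simp add: card_Diff_subset)
    have Sk: "card N + card (U - S) < k" using S(2) unfolding N_def .
    have vS: "v \<notin> S" using S(1) UW(3) by blast
    have cP: "card (insert v S) = card S + 1" using finS vS by simp
    have QV: "Q \<subseteq> V" "Q \<subseteq> W" using UW(8) unfolding Q_def by blast+
    have SV: "insert v S \<subseteq> V" using S(1) UW(7) v by blast
    have J: "joined (insert v S) Q"
    proof (intro ballI)
      fix a b assume a: "a \<in> insert v S" and b: "b \<in> Q"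
      show "H a b"
      proof (cases "a = v")
        case True
        then show ?thesis using b QV(2) unfolding W by blast
      next
        case False
        then have aS: "a \<in> S" using a by blast
        then have "\<not> E a b" using b unfolding Q_def N_def by blast
        moreover have "a \<noteq> b" using aS S(1) b QV(2) UW(2) by blast
        ultimately show ?thesis using aS SV b QV(1) unfolding nonadj_def by blast
      qed
    qed
    have k34: "k \<le> 4" "n \<le> card U + 1 \<Longrightarrow> k = 3" unfolding k_def by auto
    have cQ: "card Q \<ge> 4"
      using degree_le UW(1) cW Sk k34 n by (cases "n \<le> card U + 1") auto
    show False
    proof (cases "card S \<ge> 3")
      case True
      show False
        by (rule no_joined_pair[OF SV QV(1) J _ _ cQ]) (use True cP cU cW Sk k34 UW(1) in linarith)+
    next
      case False
      then have U5: "card U \<le> 5" using cU Sk k34(1) by linarith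
      show False
      proof (cases "card S = 2")
        case True
        then obtain a b where ab: "S = {a, b}" "a \<noteq> b" by (meson card_2_iff)
        have dist: "distinct [v, a, b]" using ab vS by auto
        show False
        proof (rule no_three_joined[OF dist QV(1)])
          show "joined {v, a, b} Q" using J ab by simp
          show "11 \<le> card Q" using cU Sk k34(1) cW UW(1) n True by linarith
          show "card {y \<in> Q. E w y} \<le> 5" if w: "w \<in> Q" for w
          proof -
            have "card {y \<in> Q. E w y} \<le> card {y \<in> V. E w y}" using QV(1) by (intro card_mono) auto
            also have "\<dots> \<le> card U" using w QV(1) by (intro max) blast
            finally show ?thesis using U5 by simp
          qed
        qed
      next
        case no2: False
        \<comment> \<open>Here \<open>card S \<le> 1\<close> and
          \<open>card (U - S) \<le> 3\<close>, while \<open>card U \<ge> n - 5 \<ge> 4\<close>, so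
          all these bounds are attained and nothing is left for \<open>N\<close>.\<close>
        have U4: "card U = 4" "n = 9" "card S = 1" "card N = 0"
          using cU Sk k34(1) large n no2 False by linarith+
        then obtain u where u: "S = {u}" by (meson card_1_singletonE)
        have "N = {}" using U4(4) NW UW(6) finite_subset by fastforce
        then have noE: "\<not> E u b" if "b \<in> W" for b using that u unfolding N_def by blast
        show False
          using small_star_case[OF U4(1,2) _ noE] S(1) u max U4(1) by auto
      qed
    qed
  qed
qed

end

theorem contradiction: False
proof -
  have "V \<noteq> {}" using card_V n by auto
  define f where "f = (\<lambda>x. card {y \<in> V. E x y})"
  have "Max (f ` V) \<in> f ` V" using finite_V \<open>V \<noteq> {}\<close> by (intro Max_in) auto
  then obtain v where v: "v \<in> V" "f v = Max (f ` V)" by auto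
  have max: "card {y \<in> V. E x y} \<le> card {y \<in> V. E v y}" if "x \<in> V" for x
    using that v(2) finite_V unfolding f_def by simp
  obtain x where "x \<in> V" "n \<le> card {y \<in> V. E x y} + 5" using large_degree_exists by blast
  then have "n \<le> card {y \<in> V. E v y} + 5" using max[of x] by linarith
  then show False using no_max_degree_vertex[OF v(1) refl refl _ max] by blast
qed

end

section \<open>The Ramsey number\<close>

lemma contains_S41:
  assumes n: "n \<ge> 9" and ms: "length ms = 4" "matching E ms" "cover ms \<subseteq> verts F - {c}" "c \<in> verts F"
    "\<forall>(a, b)\<in>set ms. E c a"
    and L: "L \<subseteq> verts F - cover ms" "\<forall>l\<in>L. E c l" "n - 9 \<le> card L"
    and E: "\<And>x y. E x y \<longleftrightarrow> {x, y} \<in> edges F" "\<And>x. \<not> E x x"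
  shows "contains_graph F (S41 n)"
proof -
  obtain L' where L': "L' \<subseteq> L" "card L' = n - 9" "finite L'"
    using L(3) by (meson obtain_subset_with_card_n)
  obtain ls where ls: "set ls = L'" "distinct ls" using L'(3) finite_distinct_list by blast
  have len: "length ls = n - 9" using ls L'(2) distinct_card by metis
  \<comment> \<open>Vertex \<open>i\<close> of \<open>S41 n\<close> goes to \<open>xs ! i\<close>.
    By \<open>edges_S41\<close> the far ends of the legs have indices 1 to 4 and the near ends the
    last four, with the leaves in between.\<close>
  define xs where "xs = c # map snd ms @ ls @ map fst ms"
  have "length xs = n" unfolding xs_def using n ms(1) len by simp
  have cov: "set (map fst ms @ map snd ms) = cover ms" unfolding cover_def by auto
  have dist: "distinct xs"
  proof -
    have "distinct (map fst ms @ map snd ms)" using ms(2) unfolding matching_def by blast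
    moreover have "set ls \<inter> cover ms = {}" "c \<notin> set ls" "c \<notin> cover ms"
      using ls(1) L'(1) L(1,2) E(2) ms(3) by auto
    ultimately show ?thesis unfolding xs_def using ls(2) cov by auto
  qed
  have star: "E c (xs ! i)" if "5 \<le> i" "i < n" for i
  proof -
    have "length (c # map snd ms) + (i - 5) = i" using that ms(1) by simp
    then have "xs ! i = ((c # map snd ms) @ (ls @ map fst ms)) ! (length (c # map snd ms) + (i - 5))"
      unfolding xs_def by simp
    then have "xs ! i = (ls @ map fst ms) ! (i - 5)" by (simp only: nth_append_length_plus)
    moreover have "i - 5 < length (ls @ map fst ms)" using that len ms(1) n by simp
    ultimately have "xs ! i \<in> set (ls @ map fst ms)" by (metis nth_mem)
    then show ?thesis using ls(1) L'(1) L(2) ms(5) by auto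
  qed
  have leg: "E (xs ! (n - 4 + j)) (xs ! (1 + j))" if j: "j < 4" for j
  proof -
    have "xs ! (n - 4 + j) = map fst ms ! j"
    proof -
      have "xs ! (n - 4 + j) = ((c # map snd ms @ ls) @ map fst ms) ! (length (c # map snd ms @ ls) + j)"
        unfolding xs_def using n ms(1) len by simp
      then show ?thesis by (simp only: nth_append_length_plus)
    qed
    moreover have "xs ! (1 + j) = map snd ms ! j"
      using j ms(1) unfolding xs_def by (simp add: nth_append)
    moreover have "E (fst (ms ! j)) (snd (ms ! j))"
    proof -
      have "ms ! j \<in> set ms" using j ms(1) by simp
      then show ?thesis using ms(2) unfolding matching_def by (auto simp: case_prod_beta)
    qed
    ultimately show ?thesis using j ms(1) by simp
  qed
  show ?thesis
    unfolding contains_graph_def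
  proof (intro exI[of _ "nth xs"] conjI ballI)
    show "inj_on ((!) xs) (verts (S41 n))"
      using dist \<open>length xs = n\<close> unfolding verts_S41[OF n] by (intro inj_on_nth) auto
    have "set xs \<subseteq> verts F"
      using ls(1) L'(1) L(1) ms(3,4) cov unfolding xs_def by auto
    then show "(!) xs ` verts (S41 n) \<subseteq> verts F"
      using \<open>length xs = n\<close> unfolding verts_S41[OF n] by auto
    fix e assume "e \<in> edges (S41 n)"
    then consider i where "e = {0, i}" "5 \<le> i" "i < n"
      | "e = {n - 4 + 0, 1 + 0}" | "e = {n - 4 + 1, 1 + 1}" | "e = {n - 4 + 2, 1 + 2}" | "e = {n - 4 + 3, 1 + 3}"
      using n unfolding edges_S41[OF n] by (auto simp: numeral_eq_Suc Suc_diff_Suc)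
    then show "(!) xs ` e \<in> edges F"
    proof cases
      case (1 i)
      have "xs ! 0 = c" unfolding xs_def by simp
      then show ?thesis using star[OF 1(2,3)] E(1) 1(1) by simp
    next
      case 2
      then show ?thesis using leg[of 0] E(1) by simp
    next
      case 3
      then show ?thesis using leg[of 1] E(1) by simp
    next
      case 4
      then show ?thesis using leg[of 2] E(1) by simp
    next
      case 5
      then show ?thesis using leg[of 3] E(1) by simp
    qed
  qed
qed

lemma contains_wheel:
  assumes xs: "length xs = 8" "distinct (h # xs)" "\<forall>x\<in>set xs. nonadj (verts F) E h x"
    "\<forall>i<8. nonadj (verts F) E (xs ! i) (xs ! ((i + 1) mod 8))"
    and E: "\<And>x y. E x y \<longleftrightarrow> {x, y} \<in> edges F"
  shows "contains_graph (graph_compl F) (wheel 8)"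
proof -
  \<comment> \<open>The hub of \<open>wheel 8\<close> is the vertex 8, so \<open>h\<close> comes
    last.\<close>
  define ys where "ys = xs @ [h]"
  have ys: "ys ! i = xs ! i" if "i < 8" for i using that xs(1) unfolding ys_def by (simp add: nth_append)
  have y8: "ys ! 8 = h" using xs(1) unfolding ys_def by (metis nth_append_length)
  have compl: "{x, y} \<in> edges (graph_compl F)" if "nonadj (verts F) E x y" for x y
    using that E unfolding nonadj_def graph_compl_def by auto
  have verts: "verts (wheel 8) = {..<9}" unfolding wheel_def cycle_graph_def by auto
  have hV: "h \<in> verts F" "set xs \<subseteq> verts F"
  proof -
    have "xs ! 0 \<in> set xs" using xs(1) by simp
    then show "h \<in> verts F" "set xs \<subseteq> verts F" using xs(3) unfolding nonadj_def by blast+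
  qed
  show ?thesis
    unfolding contains_graph_def
  proof (intro exI[of _ "nth ys"] conjI ballI)
    show "inj_on ((!) ys) (verts (wheel 8))"
      unfolding verts by (rule inj_on_nth) (use xs in \<open>auto simp: ys_def\<close>)
    have "set ys \<subseteq> verts F" "length ys = 9" using hV xs(1) unfolding ys_def by auto
    then show "(!) ys ` verts (wheel 8) \<subseteq> verts (graph_compl F)"
      unfolding verts graph_compl_def by auto
    fix e assume "e \<in> edges (wheel 8)"
    then consider i where "e = {i, (i + 1) mod 8}" "i < 8" | i where "e = {8, i}" "i < 8"
      unfolding wheel_def cycle_graph_def by auto
    then show "(!) ys ` e \<in> edges (graph_compl F)"
    proof cases
      case (1 i)
      have "(i + 1) mod 8 < 8" by simp
      then have "(!) ys ` e = {xs ! i, xs ! ((i + 1) mod 8)}" using 1 ys by simp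
      then show ?thesis using compl xs(4) 1(2) by metis
    next
      case (2 i)
      have "xs ! i \<in> set xs" using 2(2) xs(1) by simp
      moreover have "(!) ys ` e = {h, xs ! i}" using 2 ys y8 by simp
      ultimately show ?thesis using compl xs(3) by metis
    qed
  qed
qed

lemma S41_or_wheel:
  fixes F :: "'a graph"
  assumes n: "n \<ge> 9" and F: "simple_graph F" "card (verts F) = 2 * n - 1"
  shows "contains_graph F (S41 n) \<or> contains_graph (graph_compl F) (wheel 8)"
proof (rule ccontr)
  assume neg: "\<not> ?thesis"
  define E where "E = (\<lambda>x y. {x, y} \<in> edges F)"
  have irrefl: "\<not> E x x" for x using F(1) unfolding E_def simple_graph_def by fastforce
  have "counterexample (verts F) E n"
  proof
    show "finite (verts F)" using F(1) unfolding simple_graph_def by blast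
    show "E y x" if "E x y" for x y using that unfolding E_def by (simp add: insert_commute)
    show False if "length ms = 4" "matching E ms" "cover ms \<subseteq> verts F - {c}" "c \<in> verts F"
      "\<forall>(a, b)\<in>set ms. E c a" "L \<subseteq> verts F - cover ms" "\<forall>l\<in>L. E c l" "n - 9 \<le> card L" for ms c L
      using contains_S41[OF n that _ irrefl] neg unfolding E_def by blast
    show False if "length xs = 8" "distinct (h # xs)" "\<forall>x\<in>set xs. nonadj (verts F) E h x"
      "\<forall>i<8. nonadj (verts F) E (xs ! i) (xs ! ((i + 1) mod 8))" for xs h
      using contains_wheel[OF that] neg unfolding E_def by blast
  qed (use n F irrefl in auto)
  then show False by (rule counterexample.contradiction)
qed

section \<open>The lower bound\<close>

text \<open>The graph \<open>F\<close> consists of two disjoint cliques of order at most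
  \<open>n - 1\<close>, too small for the connected graph \<open>S41 n\<close>. Its complement is
  bipartite, while the hub and two consecutive rim vertices of a wheel form a triangle.\<close>

lemma two_cliques:
  assumes n: "n \<ge> 9" and N: "N < 2 * n - 1"
  obtains F :: "nat graph" where "simple_graph F" "card (verts F) = N"
    "\<not> contains_graph F (S41 n)" "\<not> contains_graph (graph_compl F) (wheel 8)"
proof -
  define same where "same = (\<lambda>x y :: nat. x < n - 1 \<longleftrightarrow> y < n - 1)"
  define F :: "nat graph" where
    "F = ({..<N}, {e. e \<subseteq> {..<N} \<and> card e = 2 \<and> (\<forall>x\<in>e. \<forall>y\<in>e. same x y)})"
  have sameE: "same x y" if "{x, y} \<in> edges F" for x y using that unfolding F_def by auto
  have "\<not> contains_graph F (S41 n)"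
  proof
    assume "contains_graph F (S41 n)"
    then obtain f where f: "inj_on f {0..<n}" "f ` {0..<n} \<subseteq> {..<N}"
      and edge: "\<And>e. e \<in> edges (S41 n) \<Longrightarrow> f ` e \<in> edges F"
      unfolding contains_graph_def verts_S41[OF n] by (auto simp: F_def)
    have adj: "same (f x) (f y)" if "{x, y} \<in> edges (S41 n)" for x y
      using edge[OF that] by (intro sameE) simp
    have big: "same (f 0) (f i)" if "5 \<le> i" "i < n" for i
      using that unfolding edges_S41[OF n] by (intro adj) (auto simp: edges_S41[OF n])
    have "same (f (n - 4)) (f 1)" "same (f (n - 3)) (f 2)" "same (f (n - 2)) (f 3)" "same (f (n - 1)) (f 4)"
      by (intro adj; simp add: edges_S41[OF n])+
    moreover have "same (f 0) (f (n - 4))" "same (f 0) (f (n - 3))" "same (f 0) (f (n - 2))" "same (f 0) (f (n - 1))"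
      by (intro big; use n in simp)+
    ultimately have small: "same (f 0) (f 1)" "same (f 0) (f 2)" "same (f 0) (f 3)" "same (f 0) (f 4)"
      unfolding same_def by blast+
    have all: "same (f 0) (f i)" if "i < n" for i
    proof -
      consider "i = 0" | "i = 1" | "i = 2" | "i = 3" | "i = 4" | "5 \<le> i" by linarith
      then show ?thesis using small big that by cases (simp_all add: same_def)
    qed
    have "f ` {0..<n} \<subseteq> {..<n - 1} \<or> f ` {0..<n} \<subseteq> {n - 1..<N}"
    proof (cases "f 0 < n - 1")
      case True
      then show ?thesis using all unfolding same_def by auto
    next
      case False
      then have "f ` {0..<n} \<subseteq> {n - 1..<N}" using all f(2) unfolding same_def by force
      then show ?thesis ..
    qed
    then have "card (f ` {0..<n}) \<le> n - 1"
    proof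
      assume "f ` {0..<n} \<subseteq> {..<n - 1}"
      then show ?thesis using card_mono[of "{..<n - 1}" "f ` {0..<n}"] by simp
    next
      assume "f ` {0..<n} \<subseteq> {n - 1..<N}"
      then have "card (f ` {0..<n}) \<le> N - (n - 1)" using card_mono[of "{n - 1..<N}" "f ` {0..<n}"] by simp
      then show ?thesis using N by linarith
    qed
    then show False using card_image[OF f(1)] n by simp
  qed
  moreover have "\<not> contains_graph (graph_compl F) (wheel 8)"
  proof
    assume "contains_graph (graph_compl F) (wheel 8)"
    then obtain f where edge: "\<And>e. e \<in> edges (wheel 8) \<Longrightarrow> f ` e \<in> edges (graph_compl F)"
      unfolding contains_graph_def by blast
    have diff: "\<not> same (f x) (f y)" if "{x, y} \<in> edges (wheel 8)" for x y
      using edge[OF that] unfolding graph_compl_def F_def same_def by auto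
    have "{8, 0} \<in> edges (wheel 8)" "{8, 1} \<in> edges (wheel 8)"
      unfolding wheel_def cycle_graph_def by auto
    moreover have "{0, 1} \<in> edges (wheel 8)"
      unfolding wheel_def cycle_graph_def by (auto intro!: exI[of _ "0 :: nat"])
    ultimately show False using diff unfolding same_def by blast
  qed
  moreover have "simple_graph F" "card (verts F) = N" unfolding simple_graph_def F_def by auto
  ultimately show thesis using that by blast
qed

theorem theorem22:
  fixes n :: nat
  assumes "n \<ge> 9"
  shows "ramsey_number (S41 n) (wheel 8) = 2 * n - 1"
  unfolding ramsey_number_def
proof (rule Least_equality)
  show "\<forall>F :: nat graph. simple_graph F \<and> card (verts F) = 2 * n - 1 \<longrightarrow>
      contains_graph F (S41 n) \<or> contains_graph (graph_compl F) (wheel 8)"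
    using S41_or_wheel[OF assms] by blast
  show "2 * n - 1 \<le> N" if "\<forall>F :: nat graph. simple_graph F \<and> card (verts F) = N \<longrightarrow>
      contains_graph F (S41 n) \<or> contains_graph (graph_compl F) (wheel 8)" for N
    using that two_cliques[OF assms, of N] by (metis not_le)
qed

end
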